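(* Let $m\geq 3$ be odd, $k\in\mathbb{C}^\times$, $\alpha\in\mathbb{C}$, and set $q=\exp(\kappa k\pi\sqrt{-1})$ and $l=\exp(\kappa\alpha\pi\sqrt{-1})/q$. For generic $\kappa$: (1) $(T_{LK}(\sigma_i)-l^{-1})(T_{LK}(\sigma_i)-q)(T_{LK}(\sigma_i)+q^{-1})=0$ for $i=0,1$; (2) $e_i=\frac{l}{q^{-1}-q}(T_{LK}(\sigma_i)-q)(T_{LK}(\sigma_i)+q^{-1})$ is a projector, meaning $\operatorname{rank} e_i=1$, for $i=0,1$.
   Context: $D_m$ is the dihedral group of order $2m$ acting on $\mathbb{R}^2$ and on its complexification $\mathbb{C}^2$. For $0\le i\le m-1$ let $H_i$ be the line through $0$ making angle $i\pi/m$ (anticlockwise) with the $x$-axis (and also its complexification), $s_i$ the reflection in $H_i$, $f_i$ a linear form on $\mathbb{C}^2$ with kernel $H_i$, $\omega_i=df_i/f_i$, and $M_m=\mathbb{C}^2\setminus\bigcup_i H_i$. Write $w(H_i)=H_{w(i)}$. The Artin group is $A_{D_m}=\pi_1(M_m/D_m)=\langle\sigma_0,\sigma_1\mid\sigma_0\sigma_1\cdots=\sigma_1\sigma_0\cdots\ (m\text{ factors})\rangle$; the base point is the image of a point $p$ in the open real sector between $H_0$ and $H_1$, and $\sigma_i$ is the class of the image of the path which follows the segment from $p$ to $s_i(p)$ except that near $H_i$ it follows the small half circle $t\mapsto p_i'-(1-e^{\pi\sqrt{-1}t})\frac{\langle p_i',a_i\rangle}{\langle a_i,a_i\rangle}a_i$,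 $t\in[0,1]$, where $a_i=s_i(p)-p$ and $p_i'$ is the point of the segment slightly before it meets $H_i$. Let $V$ be the complex vector space with basis $v_0,\dots,v_{m-1}$, $\iota(w)v_i=v_{w(i)}$, and $p_i\in\mathrm{End}(V)$ with $p_i(v_i)=\alpha v_i$, $p_i(v_j)=kv_i$ for $j\neq i$. The connection $\Omega_m=\kappa\sum_{i=0}^{m-1}(k\iota(s_i)-p_i)\omega_i$ on $M_m\times V$ is flat and $D_m$-invariant, so it induces a flat connection on the quotient bundle $(M_m\times V)/D_m$ over $M_m/D_m$; $T_{LK}:A_{D_m}\to GL(V)$ is its monodromy representation (flat sections satisfy $dF=\Omega_mF$, so that for generic $\kappa$, $T_{LK}(\sigma_i)$ is conjugate to $\iota(s_i)\exp(\pi\sqrt{-1}\kappa(k\iota(s_i)-p_i))$). In this paper "projector" means an operator with one-dimensional image. "Generic $\kappa$" means outside a proper closed complex-analytic subset of $\mathbb{C}$. *)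

theory Defs
  imports "HOL-Analysis.Analysis"
begin

subsection \<open>The dihedral group and its mirrors\<close>

text \<open>\<^term>\<open>m\<close> is the number of lines and the dihedral group of order \<open>2 m\<close> is realised by real \<open>2 \<times> 2\<close> matrices,
  acting on \<open>\<complex>\<^sup>2\<close> through their complexifications.\<close>

definition mirror_angle :: "nat \<Rightarrow> nat \<Rightarrow> real" where
  "mirror_angle m i = real i * pi / real m"

definition direction :: "real \<Rightarrow> real^2" where
  "direction \<theta> = vector [cos \<theta>, sin \<theta>]"

definition cvec :: "real^'a \<Rightarrow> complex^'a" where
  "cvec x = (\<chi> i. complex_of_real (x $ i))"

definition mirror :: "nat \<Rightarrow> nat \<Rightarrow> (complex^2) set" where
  "mirror m i = range (\<lambda>c::complex. c *s cvec (direction (mirror_angle m i)))"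

definition reflection :: "nat \<Rightarrow> nat \<Rightarrow> real^2^2" where
  "reflection m i = (let \<theta> = mirror_angle m i in
     vector [vector [cos (2 * \<theta>), sin (2 * \<theta>)],
             vector [sin (2 * \<theta>), - cos (2 * \<theta>)]])"

definition rotation :: "nat \<Rightarrow> nat \<Rightarrow> real^2^2" where
  "rotation m j = (let \<phi> = 2 * pi * real j / real m in
     vector [vector [cos \<phi>, - sin \<phi>],
             vector [sin \<phi>, cos \<phi>]])"

definition dihedral :: "nat \<Rightarrow> (real^2^2) set" where
  "dihedral m = rotation m ` {..<m} \<union> reflection m ` {..<m}"

definition cact :: "real^2^2 \<Rightarrow> complex^2 \<Rightarrow> complex^2" where
  "cact w x = map_matrix complex_of_real w *v x"

definition arr_complement :: "nat \<Rightarrow> (complex^2) set" where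
  "arr_complement m = UNIV - (\<Union>i<m. mirror m i)"

definition act_index :: "nat \<Rightarrow> real^2^2 \<Rightarrow> nat \<Rightarrow> nat" where
  "act_index m w i = (THE j. j < m \<and> cact w ` mirror m i = mirror m j)"

subsection \<open>The space V and the connection\<close>

text \<open>V is \<open>complex^'n\<close>. A bijection \<open>lab\<close> from \<open>'n\<close> onto \<open>{0..<m}\<close> names the
  standard basis: the basis vector \<open>v\<^sub>i\<close> is \<open>axis a 1\<close> where \<open>lab a = i\<close>.
  Columns of the matrices below are the images of basis vectors.\<close>

definition iota :: "nat \<Rightarrow> ('n \<Rightarrow> nat) \<Rightarrow> real^2^2 \<Rightarrow> complex^'n^'n" where
  "iota m lab w = (\<chi> a b. if lab a = act_index m w (lab b) then 1 else 0)"

definition proj_mat :: "('n \<Rightarrow> nat) \<Rightarrow> complex \<Rightarrow> complex \<Rightarrow> nat \<Rightarrow> complex^'n^'n" where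
  "proj_mat lab k \<alpha> i =
     (\<chi> a b. if lab a = i then (if lab b = i then \<alpha> else k) else 0)"

definition smat :: "complex \<Rightarrow> complex^'n^'n \<Rightarrow> complex^'n^'n" where
  "smat c A = map_matrix ((*) c) A"

definition omega :: "(complex^2 \<Rightarrow> complex) \<Rightarrow> complex^2 \<Rightarrow> complex^2 \<Rightarrow> complex" where
  "omega f x u = frechet_derivative f (at x) u / f x"

text \<open>The value at the point \<open>x\<close>, on the tangent vector \<open>u\<close>, of the
  \<open>End(V)\<close>-valued connection form; \<open>f i\<close> is a linear form defining the \<open>i\<close>-th line.\<close>

definition connection ::
  "nat \<Rightarrow> ('n \<Rightarrow> nat) \<Rightarrow> (nat \<Rightarrow> complex^2 \<Rightarrow> complex) \<Rightarrow> complex \<Rightarrow> complex \<Rightarrow> complex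
     \<Rightarrow> complex^2 \<Rightarrow> complex^2 \<Rightarrow> complex^'n^'n" where
  "connection m lab f k \<alpha> \<kappa> x u =
     smat \<kappa> (\<Sum>i<m. smat (omega (f i) x u)
       (smat k (iota m lab (reflection m i)) - proj_mat lab k \<alpha> i))"

subsection \<open>Monodromy of the induced connection on the quotient bundle\<close>

text \<open>A flat section along a path solves the pullback of \<open>dF = \<Omega> F\<close>. The path is only
  piecewise smooth, hence finitely many exceptional parameters.\<close>

definition flat_along ::
  "nat \<Rightarrow> (complex^2 \<Rightarrow> complex^2 \<Rightarrow> complex^'n^'n) \<Rightarrow> (real \<Rightarrow> complex^2) \<Rightarrow> (real \<Rightarrow> complex^'n) \<Rightarrow> bool"
  where
  "flat_along m \<Omega> \<gamma> F \<longleftrightarrow> path_image \<gamma> \<subseteq> arr_complement m \<and> continuous_on {0..1} F \<and>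
     (\<exists>S. finite S \<and> (\<forall>t \<in> {0..1} - S. \<exists>u.
        (\<gamma> has_vector_derivative u) (at t within {0..1}) \<and>
        (F has_vector_derivative \<Omega> (\<gamma> t) u *v F t) (at t within {0..1})))"

text \<open>The class of \<open>(x, v)\<close> in the quotient of \<open>M\<^sub>m \<times> V\<close> by the diagonal action.\<close>

definition quotient_pt ::
  "nat \<Rightarrow> ('n \<Rightarrow> nat) \<Rightarrow> complex^2 \<Rightarrow> complex^'n \<Rightarrow> ((complex^2) \<times> (complex^'n)) set" where
  "quotient_pt m lab x v = (\<lambda>w. (cact w x, iota m lab w *v v)) ` dihedral m"

text \<open>A loop in \<open>M\<^sub>m / D\<^sub>m\<close> is given by its lift \<open>\<gamma>\<close> to \<open>M\<^sub>m\<close>, a path whose endpoints are in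
  the same orbit. The fibre of the quotient bundle over the base point is identified with V by
  \<open>v \<mapsto> [\<gamma> 0, v]\<close>, and the monodromy sends the value of a flat section at the start of the
  loop to its value at the end. The class of \<open>\<gamma>\<close> in the fundamental group enters through this
  representative.\<close>

definition T_LK ::
  "nat \<Rightarrow> ('n \<Rightarrow> nat) \<Rightarrow> (nat \<Rightarrow> complex^2 \<Rightarrow> complex) \<Rightarrow> complex \<Rightarrow> complex \<Rightarrow> complex
     \<Rightarrow> (real \<Rightarrow> complex^2) \<Rightarrow> complex^'n^'n" where
  "T_LK m lab f k \<alpha> \<kappa> \<gamma> =
     (THE T. \<forall>F. flat_along m (connection m lab f k \<alpha> \<kappa>) \<gamma> F \<longrightarrow>
        quotient_pt m lab (pathstart \<gamma>) (T *v F 0) = quotient_pt m lab (pathfinish \<gamma>) (F 1))"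

subsection \<open>The braid generators\<close>

definition base_sector :: "nat \<Rightarrow> (real^2) set" where
  "base_sector m = {c *\<^sub>R direction \<theta> | c \<theta>. 0 < c \<and> 0 < \<theta> \<and> \<theta> < pi / real m}"

text \<open>The half circle from \<open>p'\<close> to its reflection in the line orthogonal to \<open>a\<close>.\<close>

definition half_circle :: "real^2 \<Rightarrow> real^2 \<Rightarrow> real \<Rightarrow> complex^2" where
  "half_circle p' a t =
     cvec p' - ((1 - exp (of_real (pi * t) * \<i>)) * of_real ((p' \<bullet> a) / (a \<bullet> a))) *s cvec a"

text \<open>The lift starting at \<open>p\<close> of the loop representing \<open>\<sigma>\<^sub>i\<close>. The segment from \<open>p\<close> to
  \<open>s\<^sub>i(p)\<close> meets the line at the midpoint, so the detour starts at parameter \<open>r < 1/2\<close>. It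
  encircles no other line: on the complex line through the segment, the other intersection points
  with the arrangement are real and outside the segment. Hence all such \<open>r\<close> give homotopic
  paths.\<close>

definition sigma_path :: "nat \<Rightarrow> real^2 \<Rightarrow> real \<Rightarrow> nat \<Rightarrow> real \<Rightarrow> complex^2" where
  "sigma_path m p r i =
     (let s = reflection m i; a = s *v p - p; p' = p + r *\<^sub>R a in
        linepath (cvec p) (cvec p') +++ half_circle p' a +++
        linepath (cvec (s *v p')) (cvec (s *v p)))"

subsection \<open>Generic parameters\<close>

definition analytic_subset :: "complex set \<Rightarrow> bool" where
  "analytic_subset S \<longleftrightarrow> (\<forall>z. \<exists>U G. open U \<and> z \<in> U \<and> finite G \<and>
     (\<forall>g\<in>G. g holomorphic_on U) \<and> S \<inter> U = {w \<in> U. \<forall>g\<in>G. g w = 0})"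

text \<open>An \<^const>\<open>analytic_subset\<close> is closed, because every point of the plane, not only of
  \<open>S\<close>, has a neighbourhood \<open>U\<close> as above.\<close>

definition generically :: "(complex \<Rightarrow> bool) \<Rightarrow> bool" where
  "generically P \<longleftrightarrow> (\<exists>S. analytic_subset S \<and> S \<noteq> UNIV \<and> (\<forall>\<kappa>. \<kappa> \<notin> S \<longrightarrow> P \<kappa>))"

end

theory Submission
  imports Defs
begin

text \<open>
  The path representing \<open>\<sigma>\<^sub>i\<close> lies on the complex line through \<open>p\<close> and \<open>s\<^sub>i(p)\<close>. Let \<open>x\<close> be the
  affine coordinate on this line in which \<open>p\<close>, the point of \<open>H\<^sub>i\<close> and \<open>s\<^sub>i(p)\<close> are \<open>-1/2\<close>, \<open>0\<close>
  and \<open>1/2\<close>. Each form \<open>\<omega>\<^sub>j\<close> with \<open>j \<noteq> i\<close> restricts to \<open>- y\<^sub>j dx / (1 - y\<^sub>j x)\<close> with \<open>y\<^sub>j\<close> real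
  and \<open>\<bar>y\<^sub>j\<bar> < 2\<close>, because no other mirror meets the real segment from \<open>p\<close> to \<open>s\<^sub>i(p)\<close>. So flat
  sections over the line solve the linear system \<open>F' = (A / x + R(x)) F\<close> with residue \<open>A = \<kappa> (k
  \<iota>(s\<^sub>i) - p\<^sub>i)\<close> and \<open>R\<close> holomorphic on a disc of radius greater than \<open>1/2\<close>, and the path is a
  half turn around \<open>0\<close>, through the lower half plane, inside this disc.

  If no two eigenvalues of \<open>A\<close> differ by a nonzero integer, there is a fundamental solution
  \<open>P(x) x\<^sup>A\<close> with \<open>P\<close> holomorphic on the disc and \<open>P(0) = 1\<close> (lemma \<open>Frobenius_matrix\<close>). The
  reflection \<open>s\<^sub>i\<close> acts by \<open>x \<mapsto> -x\<close> and permutes the other mirrors, so uniqueness of the power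
  series gives \<open>\<iota>(s\<^sub>i) P(x) \<iota>(s\<^sub>i) = P(-x)\<close>. Since \<open>\<iota>(s\<^sub>i)\<close> commutes with \<open>A\<close>, transporting from
  \<open>-1/2\<close> to \<open>1/2\<close> and going back to the fibre over \<open>p\<close> by \<open>\<iota>(s\<^sub>i)\<close> is, up to conjugation by the
  value of the fundamental solution at \<open>-1/2\<close>, the operator \<open>\<iota>(s\<^sub>i) exp(\<pi> \<i> A)\<close> (theorem
  \<open>half_turn_monodromy\<close>, lemma \<open>T_LK_conjugate\<close>).

  The rest is algebra in the commutative span of \<open>1\<close>, \<open>S = \<iota>(s\<^sub>i)\<close> and \<open>p\<^sub>i\<close>, where \<open>S\<^sup>2 = 1\<close>,
  \<open>S p\<^sub>i = p\<^sub>i S = p\<^sub>i\<close> and \<open>p\<^sub>i\<^sup>2 = \<alpha> p\<^sub>i\<close>. The operator \<open>S exp(\<pi> \<i> A)\<close> is \<open>q\<close> on the vectors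
  of \<open>ker p\<^sub>i\<close> fixed by \<open>S\<close>, \<open>- 1/q\<close> on those negated by \<open>S\<close>, and \<open>1/l\<close> on the image of \<open>p\<^sub>i\<close>.
  This gives the cubic relation, and \<open>(T - q)(T + 1/q)\<close> is conjugate to a multiple of \<open>p\<^sub>i\<close>, an
  operator of rank one; the factor is nonzero under the same nonresonance conditions, provided
  \<open>\<kappa> \<noteq> 0\<close> (theorem \<open>generator_relations\<close>). The computation is carried out with explicit formulas
  that also cover \<open>\<alpha> = 0\<close>, where \<open>A\<close> need not be diagonalisable. The conditions on \<open>\<kappa>\<close> fail only
  where a product of sines vanishes.
\<close>

section \<open>Matrices and scalars\<close>

named_theorems matrix_algebra

lemma smat_nth [simp]: "smat c A $ a $ b = c * A $ a $ b"
  by (simp add: smat_def map_matrix_def)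

lemma matrix_diff_rdistrib: "((A::'a::ring_1^'n^'m) - B) ** C = A ** C - B ** (C::'a^'k^'n)"
  by (vector matrix_matrix_mult_def sum_subtractf left_diff_distrib)

lemma matrix_diff_ldistrib: "(A::'a::ring_1^'n^'m) ** (B - C) = A ** B - A ** (C::'a^'k^'n)"
  by (vector matrix_matrix_mult_def sum_subtractf right_diff_distrib)

lemma matrix_add_rdistrib: "((A::'a::semiring_1^'n^'m) + B) ** C = A ** C + B ** (C::'a^'k^'n)"
  by (vector matrix_matrix_mult_def sum.distrib distrib_right)

lemma matrix_mul_zero_left: "(0::'a::semiring_1^'n^'m) ** (C::'a^'k^'n) = 0"
  and matrix_mul_zero_right: "(A::'a::semiring_1^'n^'m) ** (0::'a^'k^'n) = 0"
  by (simp_all add: matrix_matrix_mult_def vec_eq_iff)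

lemma smat_mult_left: "smat c A ** B = smat c (A ** B)"
  and smat_mult_right: "A ** smat c B = smat c (A ** B)"
  by (simp_all add: vec_eq_iff matrix_matrix_mult_def sum_distrib_left mult_ac)

lemma smat_add: "smat c (A + B) = smat c A + smat c B"
  and smat_diff: "smat c (A - B) = smat c A - smat c B"
  and smat_smat: "smat c (smat d A) = smat (c * d) A"
  and smat_minus: "smat c (- A) = smat (- c) A"
  and minus_smat: "- smat c A = smat (- c) A"
  by (simp_all add: vec_eq_iff algebra_simps)

lemma smat_zero [simp]: "smat 0 A = 0" "smat c 0 = 0"
  and smat_one [simp]: "smat 1 A = A"
  by (simp_all add: vec_eq_iff)

lemma smat_cancel: "x \<noteq> 0 \<Longrightarrow> smat x B = smat x C \<Longrightarrow> B = C"
  by (simp add: vec_eq_iff)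

lemma sum_matrix_mult_left: "(\<Sum>i\<in>I. f i) ** (B::'a::semiring_1^'k^'n) = (\<Sum>i\<in>I. (f i::'a^'n^'m) ** B)"
  by (induction I rule: infinite_finite_induct)
     (simp_all add: matrix_mul_zero_left matrix_add_rdistrib)

lemma sum_matrix_mult_right: "(B::'a::semiring_1^'n^'k) ** (\<Sum>i\<in>I. f i) = (\<Sum>i\<in>I. B ** (f i::'a^'m^'n))"
  by (induction I rule: infinite_finite_induct)
     (simp_all add: matrix_mul_zero_right matrix_add_ldistrib)

lemma smat_sum: "smat c (\<Sum>i\<in>I. f i) = (\<Sum>i\<in>I. smat c (f i))"
  by (induction I rule: infinite_finite_induct) (simp_all add: smat_add)

lemma smat_matrix_vector: "smat c A *v v = c *s (A *v v)"
  by (simp add: vec_eq_iff matrix_vector_mult_def sum_distrib_left mult_ac)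

lemmas [matrix_algebra] = matrix_diff_rdistrib matrix_diff_ldistrib matrix_add_rdistrib matrix_add_ldistrib
  matrix_mul_zero_left matrix_mul_zero_right smat_mult_left smat_mult_right smat_add smat_diff smat_smat smat_minus minus_smat

lemma matrix_entry_norm_le: "norm ((A::complex^'n^'m) $ a $ b) \<le> norm A"
  by (meson Finite_Cartesian_Product.norm_nth_le order_trans)

lemma matrix_norm_le: 
  assumes "\<And>a b. norm ((A::complex^'n^'m) $ a $ b) \<le> c"
  shows "norm A \<le> real (CARD('m)) * (real CARD('n) * c)"
proof -
  have "norm A \<le> (\<Sum>a\<in>UNIV. norm (A $ a))"
    unfolding norm_vec_def[of A] by (rule L2_set_le_sum) simp
  also have "\<dots> \<le> (\<Sum>a\<in>(UNIV::'m set). real CARD('n) * c)"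
  proof (rule sum_mono)
    fix a
    have "norm (A $ a) \<le> (\<Sum>b\<in>UNIV. norm (A $ a $ b))"
      unfolding norm_vec_def[of "A $ a"] by (rule L2_set_le_sum) simp
    also have "\<dots> \<le> (\<Sum>b\<in>(UNIV::'n set). c)"
      by (rule sum_mono) (rule assms)
    finally show "norm (A $ a) \<le> real CARD('n) * c" by simp
  qed
  finally show ?thesis by simp
qed

lemma matrix_mult_norm_le:
  fixes A B :: "complex^'n^'n"
  shows "norm (A ** B) \<le> real CARD('n) ^ 3 * norm A * norm B"
proof -
  have "norm ((A ** B) $ a $ b) \<le> real CARD('n) * (norm A * norm B)" for a b
  proof -
    have "norm ((A ** B) $ a $ b) \<le> (\<Sum>c\<in>UNIV. norm (A $ a $ c * B $ c $ b))"
      by (simp add: matrix_matrix_mult_def norm_sum)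
    also have "\<dots> \<le> (\<Sum>c\<in>(UNIV::'n set). norm A * norm B)"
      by (rule sum_mono) (auto simp: norm_mult intro!: mult_mono matrix_entry_norm_le)
    finally show ?thesis by simp
  qed
  from matrix_norm_le[OF this] show ?thesis by (simp add: power3_eq_cube mult_ac)
qed

section \<open>Power series solutions at a regular singular point\<close>

fun frobenius_coeff :: "(nat \<Rightarrow> 'a \<Rightarrow> 'a) \<Rightarrow> (nat \<Rightarrow> 'a \<Rightarrow> 'a) \<Rightarrow> 'a \<Rightarrow> nat \<Rightarrow> 'a::comm_monoid_add" where
  "frobenius_coeff G M P0 0 = P0"
| "frobenius_coeff G M P0 (Suc n) = G (Suc n) (\<Sum>j\<le>n. M (n - j) (frobenius_coeff G M P0 j))"

text \<open>
  The ratios \<open>t (Y + K/n)\<close> tend to \<open>t Y < 1\<close>, so they are eventually below the midpoint of \<open>t Y\<close>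
  and \<open>1\<close>.
\<close>
lemma summable_ratio_asymptotic:
  fixes S :: "nat \<Rightarrow> real"
  assumes nonneg: "\<And>n. S n \<ge> 0" and Y: "Y > 0" and K: "K \<ge> 0" 
    and step: "\<And>n. n \<ge> N \<Longrightarrow> S (Suc n) \<le> (Y + K / real (Suc n)) * S n"
    and t: "0 \<le> t" "t * Y < 1"
  shows "summable (\<lambda>n. S n * t ^ n)"
proof -
  define c where "c = (1 + t * Y) / 2"
  have c: "t * Y < c" "c < 1" using t by (auto simp: c_def mult.commute)
  have "(\<lambda>n. t * (Y + K / real (Suc n))) \<longlonglongrightarrow> t * (Y + 0)"
    by (intro tendsto_intros LIMSEQ_Suc lim_const_over_n)
  hence "eventually (\<lambda>n. t * (Y + K / real (Suc n)) < c) sequentially"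
    using c by (auto intro: order_tendstoD)
  then obtain N' where N': "\<And>n. n \<ge> N' \<Longrightarrow> t * (Y + K / real (Suc n)) < c"
    by (auto simp: eventually_sequentially)
  show ?thesis
  proof (rule summable_ratio_test[OF c(2), of "max N N'"])
    fix n assume n: "n \<ge> max N N'"
    have "S (Suc n) * t ^ Suc n \<le> (Y + K / real (Suc n)) * S n * t ^ Suc n"
      using step[of n] n t by (intro mult_right_mono) auto
    also have "\<dots> = (t * (Y + K / real (Suc n))) * (S n * t ^ n)" by (simp add: algebra_simps)
    also have "\<dots> \<le> c * (S n * t ^ n)"
      using N'[of n] n nonneg t by (intro mult_right_mono) auto
    finally show "norm (S (Suc n) * t ^ Suc n) \<le> c * norm (S n * t ^ n)"
      using nonneg t by simp
  qed
qed

text \<open>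
  The operator \<open>n - L\<close> is invertible for \<open>n \<ge> 1\<close>, which determines the coefficients recursively.
  For large \<open>n\<close> its inverse has norm at most \<open>2 / n\<close>, so the majorant \<open>S\<^sub>n = (\<Sum>j\<le>n. Y\<^sup>n\<^sup>-\<^sup>j
  \<parallel>P\<^sub>j\<parallel>)\<close> grows by a factor \<open>Y + O(1/n)\<close> at each step, and the series converges for \<open>t < 1/Y\<close>.
  In the application \<open>L\<close> is the commutator with a matrix.
\<close>
lemma frobenius_series:
  fixes L :: "'a::euclidean_space \<Rightarrow> 'a"
  assumes L: "linear L" 
    and nonres: "\<And>n X. n \<ge> 1 \<Longrightarrow> L X = real n *\<^sub>R X \<Longrightarrow> X = 0"
    and bound: "\<And>n X. norm (M n X) \<le> K * Y ^ n * norm X" and Y: "Y > 0"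
  obtains P where "P 0 = P0"
    "\<And>n. real (Suc n) *\<^sub>R P (Suc n) - L (P (Suc n)) = (\<Sum>j\<le>n. M (n - j) (P j))"
    "\<And>t. 0 \<le> t \<Longrightarrow> t * Y < 1 \<Longrightarrow> summable (\<lambda>n. norm (P n) * t ^ n)"
proof -
  define D where "D = (\<lambda>n X. real n *\<^sub>R X - L X)"
  have linD: "linear (D n)" for n
    unfolding D_def using L by (intro linear_compose_sub linear_scaleR) 
  have "inj (D n)" if "n \<ge> 1" for n
    using nonres[OF that] by (subst linear_injective_0[OF linD]) (auto simp: D_def)
  hence surj: "surj (D n)" if "n \<ge> 1" for n
    using linear_injective_imp_surjective[OF linD] that by blast
  define P where "P = frobenius_coeff (\<lambda>n. inv (D n)) M P0"
  have rec: "D (Suc n) (P (Suc n)) = (\<Sum>j\<le>n. M (n - j) (P j))" for n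
    using surj[of "Suc n"] by (simp add: P_def surj_f_inv_f)
  obtain B where B: "B > 0" "\<And>X. norm (L X) \<le> B * norm X"
    using linear_bounded_pos[OF L] by blast
  define K' where "K' = max K 0"
  have bound': "norm (M n X) \<le> K' * Y ^ n * norm X" for n X
    by (rule order_trans[OF bound]) (use Y in \<open>auto simp: K'_def intro!: mult_right_mono\<close>)
  define S where "S = (\<lambda>n. \<Sum>j\<le>n. Y ^ (n - j) * norm (P j))"
  have S0: "S n \<ge> 0" for n using Y by (auto simp: S_def intro!: sum_nonneg)
  have S_Suc: "S (Suc n) = Y * S n + norm (P (Suc n))" for n
    by (simp add: S_def sum_distrib_left Suc_diff_le mult.assoc)
  \<comment> \<open>from this index on, \<open>L\<close> costs at most half of \<open>n\<close>\<close>
  obtain N where N: "real N \<ge> 2 * B" using real_arch_simple by blast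
  have S_summable: "summable (\<lambda>n. S n * t ^ n)" if t: "0 \<le> t" "t * Y < 1" for t
  proof (rule summable_ratio_asymptotic[OF S0 Y _ _ t])
    show "0 \<le> 2 * K'" by (simp add: K'_def)
    fix n assume n: "n \<ge> N"
    have "real (Suc n) * norm (P (Suc n)) = norm (real (Suc n) *\<^sub>R P (Suc n))" by simp
    also have "\<dots> = norm (D (Suc n) (P (Suc n)) + L (P (Suc n)))" by (simp add: D_def)
    also have "\<dots> \<le> norm (\<Sum>j\<le>n. M (n - j) (P j)) + B * norm (P (Suc n))"
      unfolding rec by (rule order_trans[OF norm_triangle_ineq add_left_mono[OF B(2)]])
    also have "norm (\<Sum>j\<le>n. M (n - j) (P j)) \<le> (\<Sum>j\<le>n. K' * Y ^ (n - j) * norm (P j))"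
      by (rule sum_norm_le) (rule bound')
    also have "\<dots> = K' * S n" by (simp add: S_def sum_distrib_left mult.assoc)
    also have "B * norm (P (Suc n)) \<le> real (Suc n) / 2 * norm (P (Suc n))"
      using N n by (intro mult_right_mono) auto
    finally have "real (Suc n) / 2 * norm (P (Suc n)) \<le> K' * S n" by linarith
    hence "norm (P (Suc n)) \<le> 2 * K' / real (Suc n) * S n" by (simp add: field_simps)
    thus "S (Suc n) \<le> (Y + 2 * K' / real (Suc n)) * S n"
      unfolding S_Suc by (simp add: algebra_simps)
  qed
  have P_le_S: "norm (P n) \<le> S n" for n
    using member_le_sum[of n "{..n}" "\<lambda>j. Y ^ (n - j) * norm (P j)"] Y by (simp add: S_def)
  show ?thesis
  proof (rule that[of P])
    show "P 0 = P0" by (simp add: P_def)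
    show "real (Suc n) *\<^sub>R P (Suc n) - L (P (Suc n)) = (\<Sum>j\<le>n. M (n - j) (P j))" for n
      using rec[of n] unfolding D_def .
    fix t :: real assume t: "0 \<le> t" "t * Y < 1"
    show "summable (\<lambda>n. norm (P n) * t ^ n)"
    proof (rule summable_comparison_test'[OF S_summable[OF t]])
      show "norm (norm (P n) * t ^ n) \<le> S n * t ^ n" for n
        using P_le_S[of n] t(1) by (simp add: mult_right_mono)
    qed
  qed
qed

definition matrix_series :: "(nat \<Rightarrow> complex^'n^'m) \<Rightarrow> complex \<Rightarrow> complex^'n^'m" where
  "matrix_series c x = (\<chi> a b. \<Sum>n. c n $ a $ b * x ^ n)"

text \<open>Entrywise, because \<^const>\<open>has_field_derivative\<close> is about functions with values in a field.\<close>
definition matrix_deriv :: "(complex \<Rightarrow> complex^'n^'m) \<Rightarrow> complex^'n^'m \<Rightarrow> complex \<Rightarrow> bool" where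
  "matrix_deriv Y D x \<longleftrightarrow> (\<forall>a b. ((\<lambda>x. Y x $ a $ b) has_field_derivative D $ a $ b) (at x))"

lemma matrix_deriv_mult:
  assumes "matrix_deriv Y D x" "matrix_deriv Z E x"
  shows "matrix_deriv (\<lambda>x. Y x ** Z x) (D ** Z x + Y x ** E) x"
  unfolding matrix_deriv_def
proof (intro allI)
  fix a b
  have "((\<lambda>x. \<Sum>c\<in>UNIV. Y x $ a $ c * Z x $ c $ b) has_field_derivative
      (\<Sum>c\<in>UNIV. D $ a $ c * Z x $ c $ b + Y x $ a $ c * E $ c $ b)) (at x)"
    using assms unfolding matrix_deriv_def by (auto intro!: DERIV_sum derivative_eq_intros)
  thus "((\<lambda>x. (Y x ** Z x) $ a $ b) has_field_derivative (D ** Z x + Y x ** E) $ a $ b) (at x)"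
    by (simp add: matrix_matrix_mult_def sum.distrib)
qed

lemma matrix_deriv_compose:
  assumes "matrix_deriv Y D (g x)" "(g has_field_derivative c) (at x)"
  shows "matrix_deriv (\<lambda>x. Y (g x)) (smat c D) x"
  using assms unfolding matrix_deriv_def
  by (auto simp: mult.commute[of c] intro: DERIV_chain2)

lemma matrix_deriv_transpose:
  "matrix_deriv Y D x \<Longrightarrow> matrix_deriv (\<lambda>x. transpose (Y x)) (transpose D) x"
  by (simp add: matrix_deriv_def transpose_def)

lemma matrix_deriv_imp_isCont: "matrix_deriv Y D x \<Longrightarrow> isCont Y x"
  unfolding matrix_deriv_def isCont_def
  by (intro vec_tendstoI) (metis DERIV_isCont isCont_def)

lemma isCont_det:
  fixes X :: "'a::t2_space \<Rightarrow> complex^'n^'n"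
  assumes "isCont X x"
  shows "isCont (\<lambda>x. det (X x)) x"
  unfolding det_def using assms by (intro continuous_intros)

lemma scaleR_eq_smat: "r *\<^sub>R X = smat (complex_of_real r) X"
  by (simp add: vec_eq_iff) (simp add: scaleR_conv_of_real)

lemma matrix_entry_summable:
  assumes "summable (\<lambda>n. norm (c n :: complex^'n^'m) * norm x ^ n)"
  shows "summable (\<lambda>n. norm (c n $ a $ b * x ^ n))"
  by (rule summable_comparison_test'[OF assms, of 0])
     (auto simp: norm_mult norm_power intro!: mult_right_mono matrix_entry_norm_le)

lemma matrix_series_sums:
  assumes "summable (\<lambda>n. norm (c n :: complex^'n^'m) * norm x ^ n)"
  shows "(\<lambda>n. c n $ a $ b * x ^ n) sums matrix_series c x $ a $ b"
  using summable_norm_cancel[OF matrix_entry_summable[OF assms]]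
  by (simp add: matrix_series_def summable_sums)

lemma matrix_series_mult_left:
  assumes "summable (\<lambda>n. norm (c n :: complex^'n^'m) * norm x ^ n)"
  shows "(\<lambda>n. (A ** c n) $ a $ b * x ^ n) sums (A ** matrix_series c x) $ a $ b"
proof -
  have "(\<lambda>n. \<Sum>i\<in>UNIV. A $ a $ i * (c n $ i $ b * x ^ n)) sums (\<Sum>i\<in>UNIV. A $ a $ i * matrix_series c x $ i $ b)"
    by (intro sums_sum sums_mult matrix_series_sums assms)
  thus ?thesis by (simp add: matrix_matrix_mult_def sum_distrib_left mult_ac)
qed

lemma matrix_series_mult_right:
  assumes "summable (\<lambda>n. norm (c n :: complex^'n^'m) * norm x ^ n)"
  shows "(\<lambda>n. (c n ** A) $ a $ b * x ^ n) sums (matrix_series c x ** A) $ a $ b"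
proof -
  have "(\<lambda>n. \<Sum>i\<in>UNIV. (c n $ a $ i * x ^ n) * A $ i $ b) sums (\<Sum>i\<in>UNIV. matrix_series c x $ a $ i * A $ i $ b)"
    by (intro sums_sum sums_mult2 matrix_series_sums assms)
  thus ?thesis by (simp add: matrix_matrix_mult_def sum_distrib_left mult_ac)
qed

lemma matrix_series_Cauchy_product:
  assumes c: "summable (\<lambda>n. norm (c n :: complex^'n^'n) * norm x ^ n)"
    and d: "summable (\<lambda>n. norm (d n :: complex^'n^'n) * norm x ^ n)"
  shows "(\<lambda>n. (\<Sum>j\<le>n. d (n - j) ** c j) $ a $ b * x ^ n) sums (matrix_series d x ** matrix_series c x) $ a $ b"
proof -
  have "(\<lambda>n. \<Sum>j\<le>n. (c j $ i $ b * x ^ j) * (d (n - j) $ a $ i * x ^ (n - j))) sums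
      (matrix_series c x $ i $ b * matrix_series d x $ a $ i)" for i
    using Cauchy_product_sums[OF matrix_entry_summable[OF c, of i b] matrix_entry_summable[OF d, of a i]]
    by (simp add: matrix_series_def)
  from sums_sum[of UNIV, OF this]
  have "(\<lambda>n. \<Sum>i\<in>UNIV. \<Sum>j\<le>n. (c j $ i $ b * x ^ j) * (d (n - j) $ a $ i * x ^ (n - j))) sums
      (\<Sum>i\<in>UNIV. matrix_series c x $ i $ b * matrix_series d x $ a $ i)" .
  also have "(\<lambda>n. \<Sum>i\<in>UNIV. \<Sum>j\<le>n. (c j $ i $ b * x ^ j) * (d (n - j) $ a $ i * x ^ (n - j)))
      = (\<lambda>n. (\<Sum>j\<le>n. d (n - j) ** c j) $ a $ b * x ^ n)"
  proof
    fix n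
    have "(\<Sum>i\<in>UNIV. \<Sum>j\<le>n. (c j $ i $ b * x ^ j) * (d (n - j) $ a $ i * x ^ (n - j)))
       = (\<Sum>i\<in>UNIV. \<Sum>j\<le>n. d (n - j) $ a $ i * c j $ i $ b * x ^ n)"
    proof (intro sum.cong refl)
      fix i j assume "j \<in> {..n}"
      hence "x ^ n = x ^ j * x ^ (n - j)" by (simp flip: power_add)
      thus "(c j $ i $ b * x ^ j) * (d (n - j) $ a $ i * x ^ (n - j)) = d (n - j) $ a $ i * c j $ i $ b * x ^ n"
        by simp
    qed
    also have "\<dots> = (\<Sum>j\<le>n. \<Sum>i\<in>UNIV. d (n - j) $ a $ i * c j $ i $ b) * x ^ n"
      by (subst sum.swap) (simp add: sum_distrib_right)
    finally show "(\<Sum>i\<in>UNIV. \<Sum>j\<le>n. (c j $ i $ b * x ^ j) * (d (n - j) $ a $ i * x ^ (n - j)))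
        = (\<Sum>j\<le>n. d (n - j) ** c j) $ a $ b * x ^ n"
      by (simp add: matrix_matrix_mult_def)
  qed
  finally show ?thesis by (simp add: matrix_matrix_mult_def mult.commute)
qed

lemma matrix_series_deriv:
  assumes sm: "\<And>t. 0 \<le> t \<Longrightarrow> t * Y < 1 \<Longrightarrow> summable (\<lambda>n. norm (c n :: complex^'n^'m) * t ^ n)"
    and Y: "Y > 0" and x: "norm x * Y < 1"
  obtains D where "matrix_deriv (matrix_series c) D x"
    "\<And>a b. (\<lambda>n. (real (Suc n) *\<^sub>R c (Suc n)) $ a $ b * x ^ Suc n) sums (x * D $ a $ b)"
proof -
  \<comment> \<open>a radius strictly between \<open>norm x\<close> and the radius of convergence\<close>
  define t where "t = (norm x + 1 / Y) / 2"
  have t: "norm x < t" "t * Y < 1" "t \<ge> 0" using x Y by (auto simp: t_def field_simps)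
  define K where "K = complex_of_real t"
  have K: "norm K = t" using t by (simp add: K_def)
  define D where "D = (\<chi> a b. \<Sum>n. diffs (\<lambda>n. c n $ a $ b) n * x ^ n)"
  have sK: "summable (\<lambda>n. c n $ a $ b * K ^ n)" for a b
    by (rule summable_norm_cancel, rule matrix_entry_summable) (use sm[of t] t K in auto)
  have "((\<lambda>x. \<Sum>n. c n $ a $ b * x ^ n) has_field_derivative (\<Sum>n. diffs (\<lambda>n. c n $ a $ b) n * x ^ n)) (at x)" for a b
    by (rule termdiffs_strong[OF sK]) (use t K in simp)
  hence "matrix_deriv (matrix_series c) D x"
    by (simp add: matrix_deriv_def matrix_series_def D_def)
  moreover have "(\<lambda>n. (real (Suc n) *\<^sub>R c (Suc n)) $ a $ b * x ^ Suc n) sums (x * D $ a $ b)" for a b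
  proof -
    have "summable (\<lambda>n. diffs (\<lambda>n. c n $ a $ b) n * x ^ n)"
    proof (rule termdiff_converges)
      show "norm x < t" by fact
      fix z :: complex assume z: "norm z < t"
      have "norm z * Y < 1" using z Y t(2) by (meson less_trans mult_strict_right_mono)
      thus "summable (\<lambda>n. c n $ a $ b * z ^ n)"
        by (intro summable_norm_cancel[OF matrix_entry_summable] sm) auto
    qed
    hence "(\<lambda>n. diffs (\<lambda>n. c n $ a $ b) n * x ^ n) sums D $ a $ b"
      by (simp add: D_def summable_sums)
    from sums_mult[OF this, of x] show ?thesis
      unfolding diffs_def vector_scaleR_component by (simp add: scaleR_conv_of_real[where 'a=complex] mult_ac)
  qed
  ultimately show ?thesis by (rule that)
qed

lemma geometric_bound_summable:
  assumes bound: "\<And>n. norm (R n :: complex^'n^'m) \<le> K * Y ^ n" and Y: "Y > 0" and t: "0 \<le> t" "t * Y < 1"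
  shows "summable (\<lambda>n. norm (R n) * t ^ n)"
proof (rule summable_comparison_test')
  show "summable (\<lambda>n. K * (t * Y) ^ n)" using t Y by (intro summable_mult summable_geometric) auto
  show "norm (norm (R n) * t ^ n) \<le> K * (t * Y) ^ n" for n
    using mult_right_mono[OF bound[of n], of "t ^ n"] t by (simp add: power_mult_distrib mult_ac)
qed

text \<open>
  For a solution \<open>P(x) x\<^sup>A\<close> of \<open>F' = (A/x + R(x)) F\<close> the regular part has to satisfy \<open>x P' = [A,
  P] + x R P\<close>. In terms of coefficients, \<open>n P\<^sub>n - [A, P\<^sub>n]\<close> is a convolution of \<open>R\<close> with earlier
  coefficients, and nonresonance is the statement that \<open>n\<close> is not an eigenvalue of the
  commutator. The last conclusion is the uniqueness of these coefficients: conjugating by a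
  symmetry \<open>S\<close> under which \<open>R(-x) = - S R(x) S\<close> gives the same recursion as replacing \<open>x\<close> by
  \<open>-x\<close>.
\<close>
lemma Frobenius_matrix:
  fixes A :: "complex^'n^'n" and R :: "nat \<Rightarrow> complex^'n^'n"
  assumes nonres: "\<And>n X. n \<ge> 1 \<Longrightarrow> A ** X - X ** A = smat (of_nat n) X \<Longrightarrow> X = 0"
    and bound: "\<And>n. norm (R n) \<le> K * Y ^ n" and Y: "Y > 0"
  obtains P where
    "matrix_series P 0 = mat 1"
    "\<And>x. norm x * Y < 1 \<Longrightarrow> isCont (matrix_series P) x"
    "\<And>x. norm x * Y < 1 \<Longrightarrow> \<exists>D. matrix_deriv (matrix_series P) D x \<and>
        smat x D = A ** matrix_series P x - matrix_series P x ** A + smat x (matrix_series R x ** matrix_series P x)"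
    "\<And>S x. S ** S = mat 1 \<Longrightarrow> S ** A = A ** S \<Longrightarrow> (\<And>n. S ** R n ** S = smat ((-1) ^ Suc n) (R n))
        \<Longrightarrow> norm x * Y < 1 \<Longrightarrow> S ** matrix_series P x ** S = matrix_series P (-x)"
proof -
  define L where "L = (\<lambda>X :: complex^'n^'n. A ** X - X ** A)"
  have linL: "linear L"
    by (rule linearI) (auto simp: L_def scaleR_eq_smat matrix_algebra)
  have nonres': "X = 0" if "n \<ge> 1" "L X = real n *\<^sub>R X" for n X
    using nonres[of n X] that by (simp add: L_def scaleR_eq_smat)
  have Mbound: "norm (R n ** X) \<le> (real CARD('n) ^ 3 * K) * Y ^ n * norm X" for n and X :: "complex^'n^'n"
  proof -
    have "norm (R n ** X) \<le> real CARD('n) ^ 3 * norm (R n) * norm X" by (rule matrix_mult_norm_le)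
    also have "\<dots> \<le> real CARD('n) ^ 3 * (K * Y ^ n) * norm X"
      by (intro mult_right_mono mult_left_mono bound) auto
    finally show ?thesis by (simp add: mult_ac)
  qed
  obtain P where P0: "P 0 = mat 1"
    and rec: "\<And>n. real (Suc n) *\<^sub>R P (Suc n) - L (P (Suc n)) = (\<Sum>j\<le>n. R (n - j) ** P j)"
    and sm: "\<And>t. 0 \<le> t \<Longrightarrow> t * Y < 1 \<Longrightarrow> summable (\<lambda>n. norm (P n) * t ^ n)"
    by (rule frobenius_series[OF linL _ Mbound Y, where ?P0.0 = "mat 1"]) (use nonres' in auto)
  have smR: "summable (\<lambda>n. norm (R n) * t ^ n)" if "0 \<le> t" "t * Y < 1" for t
    using bound Y that by (rule geometric_bound_summable)
  show ?thesis
  proof (rule that[of P])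
    show "matrix_series P 0 = mat 1" by (simp add: matrix_series_def vec_eq_iff P0)
  next
    fix x :: complex assume x: "norm x * Y < 1"
    obtain D where "matrix_deriv (matrix_series P) D x" by (rule matrix_series_deriv[OF sm Y x])
    thus "isCont (matrix_series P) x" by (rule matrix_deriv_imp_isCont)
  next
    fix x :: complex assume x: "norm x * Y < 1"
    obtain D where D: "matrix_deriv (matrix_series P) D x"
      "\<And>a b. (\<lambda>n. (real (Suc n) *\<^sub>R P (Suc n)) $ a $ b * x ^ Suc n) sums (x * D $ a $ b)"
      using matrix_series_deriv[OF sm Y x] by blast
    note smx = sm[OF norm_ge_zero x] and smRx = smR[OF norm_ge_zero x]
    have "x * D $ a $ b = (A ** matrix_series P x - matrix_series P x ** A
        + smat x (matrix_series R x ** matrix_series P x)) $ a $ b" for a b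
    proof (rule sums_unique2[OF D(2)])
      have "(\<lambda>n. (A ** P n) $ a $ b * x ^ n - (P n ** A) $ a $ b * x ^ n) sums
          ((A ** matrix_series P x) $ a $ b - (matrix_series P x ** A) $ a $ b)"
        by (intro sums_diff matrix_series_mult_left matrix_series_mult_right smx)
      hence "(\<lambda>n. L (P n) $ a $ b * x ^ n) sums ((A ** matrix_series P x - matrix_series P x ** A) $ a $ b)"
        by (simp add: L_def algebra_simps)
      moreover have "L (P 0) $ a $ b = 0" by (simp add: L_def P0)
      ultimately have "(\<lambda>n. L (P (Suc n)) $ a $ b * x ^ Suc n) sums ((A ** matrix_series P x - matrix_series P x ** A) $ a $ b)"
        by (subst sums_Suc_iff) simp
      from sums_add[OF this sums_mult[OF matrix_series_Cauchy_product[OF smx smRx, of a b], of x]]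
      have "(\<lambda>n. L (P (Suc n)) $ a $ b * x ^ Suc n + x * ((\<Sum>j\<le>n. R (n - j) ** P j) $ a $ b * x ^ n)) sums
        ((A ** matrix_series P x - matrix_series P x ** A
        + smat x (matrix_series R x ** matrix_series P x)) $ a $ b)" by simp
      moreover have "real (Suc n) *\<^sub>R P (Suc n) = L (P (Suc n)) + (\<Sum>j\<le>n. R (n - j) ** P j)" for n
        using rec[of n] by (simp add: algebra_simps)
      hence "L (P (Suc n)) $ a $ b * x ^ Suc n + x * ((\<Sum>j\<le>n. R (n - j) ** P j) $ a $ b * x ^ n)
          = (real (Suc n) *\<^sub>R P (Suc n)) $ a $ b * x ^ Suc n" for n
        by (simp only: vector_add_component) (simp add: algebra_simps)
      ultimately show "(\<lambda>n. (real (Suc n) *\<^sub>R P (Suc n)) $ a $ b * x ^ Suc n) sums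
        ((A ** matrix_series P x - matrix_series P x ** A
        + smat x (matrix_series R x ** matrix_series P x)) $ a $ b)" by simp
    qed
    hence "smat x D = A ** matrix_series P x - matrix_series P x ** A + smat x (matrix_series R x ** matrix_series P x)"
      by (simp add: vec_eq_iff)
    with D(1) show "\<exists>D. matrix_deriv (matrix_series P) D x \<and> smat x D
      = A ** matrix_series P x - matrix_series P x ** A + smat x (matrix_series R x ** matrix_series P x)" by blast
  next
    fix S x assume SS: "S ** S = mat 1" and SA: "S ** A = A ** S"
      and SR: "\<And>n. S ** R n ** S = smat ((-1) ^ Suc n) (R n)" and x: "norm (x::complex) * Y < 1"
    have conj_mult: "S ** (B ** C) ** S = (S ** B ** S) ** (S ** C ** S)" for B C
    proof -
      have "(S ** B ** S) ** (S ** C ** S) = S ** B ** (S ** S) ** C ** S" by (simp only: matrix_mul_assoc)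
      thus ?thesis by (simp add: SS matrix_mul_assoc)
    qed
    have conj_A: "S ** A ** S = A" by (simp add: SA SS flip: matrix_mul_assoc)
    have conj_P: "S ** P n ** S = smat ((-1) ^ n) (P n)" for n
    proof (induction n rule: less_induct)
      case (less n)
      show ?case
      proof (cases n)
        case 0
        thus ?thesis by (simp add: P0 SS)
      next
        case (Suc l)
        define X where "X = S ** P n ** S - smat ((-1) ^ n) (P n)"
        have "smat (of_nat n) X - L X = S ** (smat (of_nat n) (P n) - L (P n)) ** S
            - smat ((-1) ^ n) (smat (of_nat n) (P n) - L (P n))"
          by (simp add: X_def L_def matrix_algebra conj_mult conj_A mult_ac)
        also have "smat (of_nat n) (P n) - L (P n) = (\<Sum>j\<le>l. R (l - j) ** P j)"
          using rec[of l] by (simp add: Suc scaleR_eq_smat)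
        also have "S ** (\<Sum>j\<le>l. R (l - j) ** P j) ** S = (\<Sum>j\<le>l. (S ** R (l - j) ** S) ** (S ** P j ** S))"
          by (simp add: sum_matrix_mult_left sum_matrix_mult_right conj_mult)
        also have "\<dots> = (\<Sum>j\<le>l. smat ((-1) ^ n) (R (l - j) ** P j))"
        proof (intro sum.cong refl)
          fix j assume j: "j \<in> {..l}"
          have "(- 1 :: complex) ^ Suc (l - j) * (-1) ^ j = (-1) ^ n"
            using j Suc by (simp flip: power_add power_Suc)
          thus "(S ** R (l - j) ** S) ** (S ** P j ** S) = smat ((-1) ^ n) (R (l - j) ** P j)"
            using less.IH[of j] j Suc by (simp add: SR matrix_algebra mult_ac)
        qed
        also have "\<dots> - smat ((-1) ^ n) (\<Sum>j\<le>l. R (l - j) ** P j) = 0"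
          by (simp add: smat_sum)
        finally have "A ** X - X ** A = smat (of_nat n) X" by (simp add: L_def)
        hence "X = 0" using Suc by (intro nonres[of n]) auto
        thus ?thesis by (simp add: X_def)
      qed
    qed
    note smx = sm[OF norm_ge_zero x]
    have "summable (\<lambda>n. norm (S ** P n) * norm x ^ n)"
    proof (rule summable_comparison_test')
      show "summable (\<lambda>n. real CARD('n) ^ 3 * norm S * (norm (P n) * norm x ^ n))" 
        using smx by (rule summable_mult)
      show "norm (norm (S ** P n) * norm x ^ n) \<le> real CARD('n) ^ 3 * norm S * (norm (P n) * norm x ^ n)" for n
        using mult_right_mono[OF matrix_mult_norm_le[of S "P n"], of "norm x ^ n"] by (simp add: mult_ac)
    qed
    from matrix_series_mult_right[OF this, of S]
    have *: "(\<lambda>n. (S ** P n ** S) $ a $ b * x ^ n) sums (matrix_series (\<lambda>n. S ** P n) x ** S) $ a $ b" for a b .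
    have "matrix_series (\<lambda>n. S ** P n) x = S ** matrix_series P x"
      using matrix_series_mult_left[OF smx, of S]
      by (auto simp: vec_eq_iff matrix_series_def sums_iff)
    with * have "(\<lambda>n. (S ** P n ** S) $ a $ b * x ^ n) sums (S ** matrix_series P x ** S) $ a $ b" for a b
      by simp
    moreover have "(S ** P n ** S) $ a $ b * x ^ n = P n $ a $ b * (-x) ^ n" for n a b
      unfolding conj_P by (simp add: power_minus[of x])
    ultimately show "S ** matrix_series P x ** S = matrix_series P (-x)"
      by (auto simp: vec_eq_iff matrix_series_def[of P "-x"] sums_iff)
  qed
qed

lemma matrix_minus_mult: "(- (B::'a::ring_1^'n^'m)) ** C = - (B ** C)" "B ** (- C) = - (B ** (C::'a^'k^'n))"
  by (simp_all add: vec_eq_iff matrix_matrix_mult_def sum_negf)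

lemma transpose_diff: "transpose (B - C) = transpose B - transpose (C::'a::ring_1^'n^'m)"
  and transpose_minus: "transpose (- B) = - transpose (B::'a::ring_1^'n^'m)"
  and transpose_smat: "transpose (smat c D) = smat c (transpose D)"
  by (simp_all add: vec_eq_iff transpose_def)

lemma has_vector_derivative_vecI:
  fixes F :: "real \<Rightarrow> 'a::{euclidean_space,real_algebra_1} ^ 'n"
  assumes "\<And>a. ((\<lambda>t. F t $ a) has_vector_derivative D $ a) net"
  shows "(F has_vector_derivative D) net"
proof -
  have axis: "bounded_linear (axis a :: 'a \<Rightarrow> 'a ^ 'n)" for a
    by (intro linear_conv_bounded_linear[THEN iffD1] linearI) (auto simp: vec_eq_iff axis_def)
  have sum_axis: "v = (\<Sum>a\<in>UNIV. axis a (v $ a))" for v :: "'a ^ 'n"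
    by (simp add: vec_eq_iff axis_def)
  have "((\<lambda>t. \<Sum>a\<in>UNIV. axis a (F t $ a)) has_vector_derivative (\<Sum>a\<in>UNIV. axis a (D $ a))) net"
    by (intro has_vector_derivative_sum bounded_linear.has_vector_derivative[OF axis] assms)
  thus ?thesis by (simp flip: sum_axis)
qed

section \<open>The residue: a commuting reflection and rank-one operator\<close>

text \<open>
  The relations between \<open>S = \<iota>(s\<^sub>i)\<close> and \<open>p = p\<^sub>i\<close>. They make \<open>1\<close>, \<open>S\<close>, \<open>p\<close> span a commutative
  algebra whose characters send \<open>(S, p)\<close> to \<open>(1, 0)\<close>, \<open>(-1, 0)\<close> and \<open>(1, \<alpha>)\<close>.
\<close>
locale reflection_and_projector =
  fixes S p :: "complex^'n^'n" and \<alpha> :: complex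
  assumes SS: "S ** S = mat 1" and Sp: "S ** p = p" and pS: "p ** S = p" and pp: "p ** p = smat \<alpha> p"
begin

text \<open>
  Coordinates with respect to the idempotents \<open>(1 + S)/2\<close>, \<open>(1 - S)/2\<close> and to \<open>p\<close>. The three
  characters take the values \<open>c1\<close>, \<open>c2\<close> and \<open>c1 + \<alpha> c3\<close>. For \<open>\<alpha> = 0\<close> the first and the third
  coincide and \<open>p\<close> is nilpotent, hence coordinates rather than an eigenbasis.
\<close>
definition elt :: "complex \<Rightarrow> complex \<Rightarrow> complex \<Rightarrow> complex^'n^'n" where
  "elt c1 c2 c3 = smat ((c1 + c2) / 2) (mat 1) + smat ((c1 - c2) / 2) S + smat c3 p"

lemma elt_mult: "elt c1 c2 c3 ** elt d1 d2 d3 = elt (c1 * d1) (c2 * d2) (c1 * d3 + c3 * d1 + \<alpha> * c3 * d3)"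
  unfolding elt_def
  by (simp add: matrix_algebra SS Sp pS pp) (simp add: vec_eq_iff field_simps)

lemma elt_add: "elt c1 c2 c3 + elt d1 d2 d3 = elt (c1 + d1) (c2 + d2) (c3 + d3)"
  and elt_diff: "elt c1 c2 c3 - elt d1 d2 d3 = elt (c1 - d1) (c2 - d2) (c3 - d3)"
  and smat_elt: "smat c (elt c1 c2 c3) = elt (c * c1) (c * c2) (c * c3)"
  unfolding elt_def by (simp_all add: vec_eq_iff field_simps)

lemma mat_eq_elt: "mat c = elt c c 0"
  and S_eq_elt: "S = elt 1 (-1) 0"
  by (simp_all add: elt_def vec_eq_iff mat_def)

lemma elt_commute: "elt c1 c2 c3 ** elt d1 d2 d3 = elt d1 d2 d3 ** elt c1 c2 c3"
  by (simp add: elt_mult algebra_simps)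

text \<open>Elements on which no character vanishes are invertible.\<close>
lemma elt_cancel:
  assumes "X ** elt c1 c2 c3 = 0" "c1 \<noteq> 0" "c2 \<noteq> 0" "c1 + \<alpha> * c3 \<noteq> 0"
  shows "X = 0"
proof -
  \<comment> \<open>the third coordinate solves \<open>c1 d3 + c3 / c1 + \<alpha> c3 d3 = 0\<close>\<close>
  have "elt c1 c2 c3 ** elt (1 / c1) (1 / c2) (- c3 / (c1 * (c1 + \<alpha> * c3))) = elt 1 1 0"
    unfolding elt_mult using assms(2-) by (simp add: divide_simps) (simp add: algebra_simps)
  hence "X = X ** (elt c1 c2 c3 ** elt (1 / c1) (1 / c2) (- c3 / (c1 * (c1 + \<alpha> * c3))))"
    by (simp flip: mat_eq_elt)
  also have "\<dots> = 0" by (simp add: matrix_mul_assoc assms(1) matrix_mul_zero_left)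
  finally show ?thesis .
qed

text \<open>\<open>exp (- u p) = 1 + p_exponent u \<cdot> p\<close>; the case \<open>\<alpha> = 0\<close> is the limit \<open>\<alpha> \<rightarrow> 0\<close>.\<close>
definition p_exponent :: "complex \<Rightarrow> complex" where
  "p_exponent u = (if \<alpha> = 0 then - u else (exp (- \<alpha> * u) - 1) / \<alpha>)"

text \<open>\<open>exp (u (k S - p))\<close>, the factors \<open>exp (u k S)\<close> and \<open>exp (- u p)\<close> being multiplied out.\<close>
definition residue_exp :: "complex \<Rightarrow> complex \<Rightarrow> complex^'n^'n" where
  "residue_exp k u = elt (exp (k * u)) (exp (- k * u)) (exp (k * u) * p_exponent u)"

lemma p_exponent_eq: "1 + \<alpha> * p_exponent u = exp (- \<alpha> * u)"
  by (simp add: p_exponent_def)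

lemma p_exponent_add: "p_exponent (u + v) = p_exponent u + p_exponent v + \<alpha> * p_exponent u * p_exponent v"
proof -
  have "exp (- \<alpha> * (u + v)) = exp (- \<alpha> * u) * exp (- \<alpha> * v)"
    by (simp add: algebra_simps flip: exp_add)
  thus ?thesis
    unfolding p_exponent_def by (simp add: divide_simps) (simp add: algebra_simps)
qed

lemma residue_exp_add: "residue_exp k (u + v) = residue_exp k u ** residue_exp k v"
proof -
  have "exp (c * (u + v)) = exp (c * u) * exp (c * v)" for c
    by (simp add: algebra_simps flip: exp_add)
  thus ?thesis
    unfolding residue_exp_def elt_mult p_exponent_add by (simp only:) (simp add: algebra_simps)
qed

lemma residue_exp_zero: "residue_exp k 0 = mat 1"
  by (simp add: residue_exp_def p_exponent_def mat_eq_elt)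

lemma residue_exp_inverse: "residue_exp k u ** residue_exp k (- u) = mat 1" "residue_exp k (- u) ** residue_exp k u = mat 1"
  using residue_exp_add[of k u "-u"] residue_exp_add[of k "-u" u] by (simp_all add: residue_exp_zero)

lemma residue_exp_deriv: "matrix_deriv (residue_exp k) (elt k (- k) (- 1) ** residue_exp k u) u"
proof -
  have "(p_exponent has_field_derivative (- exp (- \<alpha> * u))) (at u)"
    unfolding p_exponent_def by (cases "\<alpha> = 0") (auto intro!: derivative_eq_intros)
  hence c: "(p_exponent has_field_derivative (- (1 + \<alpha> * p_exponent u))) (at u)"
    by (simp add: p_exponent_eq)
  show ?thesis
    unfolding matrix_deriv_def residue_exp_def elt_mult
    unfolding elt_def
    by (auto intro!: derivative_eq_intros c simp: field_simps)
qed

end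

section \<open>Monodromy along a half turn around the singular point\<close>

text \<open>
  The system \<open>F' = (A/x + R(x)) F\<close> whose residue \<open>A\<close> has eigenvalues \<open>\<kappa> k\<close>, \<open>- \<kappa> k\<close> and \<open>\<kappa> (k -
  \<alpha>)\<close>; the first assumption says that no two of them differ by a nonzero integer. The last
  assumption is the invariance of the system under \<open>x \<mapsto> -x\<close> combined with \<open>S\<close>.
\<close>
locale frobenius_problem = reflection_and_projector S p \<alpha>
  for S p :: "complex^'n^'n" and \<alpha> :: complex +
  fixes k \<kappa> :: complex and R :: "nat \<Rightarrow> complex^'n^'n" and K Y :: real
  assumes nonres: "\<And>n::int. n \<noteq> 0 \<Longrightarrow> 2 * \<kappa> * k \<noteq> of_int n \<and> \<kappa> * \<alpha> \<noteq> of_int n \<and> \<kappa> * (2 * k - \<alpha>) \<noteq> of_int n"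
    and bound: "\<And>n. norm (R n) \<le> K * Y ^ n" and Y: "Y > 0"
    and SR: "\<And>n. S ** R n ** S = smat ((-1) ^ Suc n) (R n)"
begin

definition A where "A = smat \<kappa> (smat k S - p)"

lemma A_eq_elt: "A = elt (\<kappa> * k) (- \<kappa> * k) (- \<kappa>)"
  by (simp add: A_def elt_def vec_eq_iff field_simps)

text \<open>
  If \<open>A X - X A = n X\<close> then \<open>(A - c) X = X (A - (c - n))\<close> for every scalar \<open>c\<close>. Taking for \<open>c\<close>
  the three eigenvalues, whose factors multiply to \<open>0\<close> on the left, leaves three factors on the
  right, which are invertible because no \<open>c - n\<close> is an eigenvalue.
\<close>
lemma nonresonant:
  assumes "n \<ge> 1" "A ** X - X ** A = smat (of_nat n) X"
  shows "X = 0"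
proof -
  define F where "F = (\<lambda>c. elt (\<kappa> * k - c) (- \<kappa> * k - c) (- \<kappa>))"
  have F: "F c = A - mat c" for c by (simp add: F_def A_eq_elt mat_eq_elt elt_diff)
  have mat_smat: "mat c = smat c (mat 1 :: complex^'n^'n)" for c by (simp add: vec_eq_iff mat_def)
  have FX: "F c ** X = X ** F (c - of_nat n)" for c
  proof -
    have "A ** X = X ** A + smat (of_nat n) X" using assms(2) by (simp add: algebra_simps)
    moreover have "mat c ** X = smat c X" "X ** mat c = smat c X" for c
      unfolding mat_smat[of c] by (simp_all add: matrix_algebra)
    ultimately show ?thesis unfolding F by (simp add: matrix_algebra) (simp add: vec_eq_iff algebra_simps)
  qed
  define l1 l2 l3 where "l1 = \<kappa> * k" and "l2 = - \<kappa> * k" and "l3 = \<kappa> * (k - \<alpha>)"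
  have "F l1 ** F l2 ** F l3 = 0"
    unfolding F_def elt_mult l1_def l2_def l3_def by (simp add: elt_def algebra_simps)
  hence "0 = F l1 ** F l2 ** F l3 ** X" by (simp add: matrix_mul_zero_left)
  also have "\<dots> = X ** F (l1 - of_nat n) ** F (l2 - of_nat n) ** F (l3 - of_nat n)"
    by (metis FX matrix_mul_assoc)
  finally have *: "X ** F (l1 - of_nat n) ** F (l2 - of_nat n) ** F (l3 - of_nat n) = 0" by simp
  note nr = nonres[of "int n"] nonres[of "- int n"]
  have F_cancel: "X' = 0" if "X' ** F c = 0" "\<kappa> * k \<noteq> c" "- \<kappa> * k \<noteq> c" "\<kappa> * (k - \<alpha>) \<noteq> c" for X' c
    by (rule elt_cancel[OF that(1)[unfolded F_def]]) (use that in \<open>auto simp: algebra_simps\<close>)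
  have neq: "x \<noteq> y" if "a \<noteq> b" "x - y = a - b \<or> x - y = b - a" for a b x y :: complex
    using that by auto
  have n0: "of_nat n \<noteq> (0::complex)" using assms(1) by simp
  have plus: "2 * \<kappa> * k \<noteq> of_nat n" "\<kappa> * \<alpha> \<noteq> of_nat n" "\<kappa> * (2 * k - \<alpha>) \<noteq> of_nat n"
    and minus: "2 * \<kappa> * k \<noteq> - of_nat n" "\<kappa> * \<alpha> \<noteq> - of_nat n" "\<kappa> * (2 * k - \<alpha>) \<noteq> - of_nat n"
    using nonres[of "int n"] nonres[of "- int n"] assms(1) by simp_all
  have "X ** F (l1 - of_nat n) ** F (l2 - of_nat n) = 0"
  proof (rule F_cancel[OF *])
    show "\<kappa> * k \<noteq> l3 - of_nat n"
      by (rule neq[OF minus(2)]) (simp add: l3_def algebra_simps)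
    show "- \<kappa> * k \<noteq> l3 - of_nat n"
      by (rule neq[OF plus(3)]) (simp add: l3_def algebra_simps)
    show "\<kappa> * (k - \<alpha>) \<noteq> l3 - of_nat n"
      by (rule neq[OF n0]) (simp add: l3_def)
  qed
  hence "X ** F (l1 - of_nat n) = 0"
  proof (rule F_cancel)
    show "\<kappa> * k \<noteq> l2 - of_nat n"
      by (rule neq[OF minus(1)]) (simp add: l2_def algebra_simps)
    show "- \<kappa> * k \<noteq> l2 - of_nat n"
      by (rule neq[OF n0]) (simp add: l2_def)
    show "\<kappa> * (k - \<alpha>) \<noteq> l2 - of_nat n"
      by (rule neq[OF minus(3)]) (simp add: l2_def algebra_simps)
  qed
  thus "X = 0"
  proof (rule F_cancel)
    show "\<kappa> * k \<noteq> l1 - of_nat n"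
      by (rule neq[OF n0]) (simp add: l1_def)
    show "- \<kappa> * k \<noteq> l1 - of_nat n"
      by (rule neq[OF plus(1)]) (simp add: l1_def algebra_simps)
    show "\<kappa> * (k - \<alpha>) \<noteq> l1 - of_nat n"
      by (rule neq[OF plus(2)]) (simp add: l1_def algebra_simps)
  qed
qed

lemma nonresonant_transpose:
  assumes "n \<ge> 1" "(- transpose A) ** X - X ** (- transpose A) = smat (of_nat n) X"
  shows "X = 0"
proof -
  have "transpose (smat (of_nat n) X) = transpose (X ** transpose A - transpose A ** X)"
    using assms(2) by (simp add: matrix_minus_mult)
  hence "A ** transpose X - transpose X ** A = smat (of_nat n) (transpose X)"
    by (simp add: transpose_diff matrix_transpose_mul transpose_smat)
  from nonresonant[OF assms(1) this] have "transpose (transpose X) = transpose 0" by simp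
  thus ?thesis by (simp add: vec_eq_iff transpose_def)
qed

definition coeff :: "complex \<Rightarrow> complex^'n^'n" where
  "coeff x = smat (1 / x) A + matrix_series R x"

text \<open>
  The disc without the closed positive imaginary half line, along which \<open>Ln (\<i> x)\<close> has its cut.
  The half turn through the lower half plane avoids it.
\<close>
definition cut_disc :: "complex set" where
  "cut_disc = {x. x \<noteq> 0 \<and> \<i> * x \<notin> \<real>\<^sub>\<le>\<^sub>0 \<and> norm x * Y < 1}"

lemma A_residue_exp_commute: "A ** residue_exp k u = residue_exp k u ** A"
  by (simp add: A_eq_elt residue_exp_def elt_commute)

lemma residue_exp_log_deriv:
  assumes "x \<in> cut_disc"
  shows "matrix_deriv (\<lambda>x. residue_exp k (c * \<kappa> * Ln (\<i> * x))) (smat (c / x) (A ** residue_exp k (c * \<kappa> * Ln (\<i> * x)))) x"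
proof -
  have x: "x \<noteq> 0" "\<i> * x \<notin> \<real>\<^sub>\<le>\<^sub>0" using assms by (auto simp: cut_disc_def)
  have "((\<lambda>x. c * \<kappa> * Ln (\<i> * x)) has_field_derivative (c * \<kappa> / x)) (at x)"
    using x by (auto intro!: derivative_eq_intros simp: field_simps)
  from matrix_deriv_compose[OF residue_exp_deriv this, of k]
  have "matrix_deriv (\<lambda>x. residue_exp k (c * \<kappa> * Ln (\<i> * x)))
    (smat (c * \<kappa> / x) (elt k (- k) (- 1) ** residue_exp k (c * \<kappa> * Ln (\<i> * x)))) x" .
  also have "smat (c * \<kappa> / x) (elt k (- k) (- 1) ** residue_exp k (c * \<kappa> * Ln (\<i> * x))) =
    smat (c / x) (A ** residue_exp k (c * \<kappa> * Ln (\<i> * x)))"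
    by (simp add: A_eq_elt residue_exp_def elt_mult smat_elt algebra_simps)
  finally show ?thesis .
qed

lemma solution_from_regular_part:
  assumes x: "x \<in> cut_disc" and D: "matrix_deriv P D x"
    and eq: "smat x D = A ** P x - P x ** A + smat x (matrix_series R x ** P x)"
  defines "W \<equiv> \<lambda>x. P x ** residue_exp k (\<kappa> * Ln (\<i> * x))"
  shows "matrix_deriv W (coeff x ** W x) x"
proof -
  have x0: "x \<noteq> 0" using x by (auto simp: cut_disc_def)
  define F where "F = residue_exp k (\<kappa> * Ln (\<i> * x))"
  have "matrix_deriv W (D ** F + P x ** smat (1 / x) (A ** F)) x"
    unfolding W_def F_def using residue_exp_log_deriv[OF x, of 1] by (intro matrix_deriv_mult D) simp
  moreover have "D ** F + P x ** smat (1 / x) (A ** F) = coeff x ** W x"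
  proof (rule smat_cancel[OF x0])
    have "smat x (D ** F + P x ** smat (1 / x) (A ** F)) = smat x D ** F + P x ** A ** F"
      using x0 by (simp add: matrix_algebra matrix_mul_assoc)
    also have "\<dots> = smat x (coeff x ** (P x ** F))"
      unfolding eq coeff_def using x0 by (simp add: matrix_algebra matrix_mul_assoc)
    finally show "smat x (D ** F + P x ** smat (1 / x) (A ** F)) = smat x (coeff x ** W x)"
      by (simp add: W_def F_def)
  qed
  ultimately show ?thesis by simp
qed

text \<open>
  Solutions of the dual system \<open>V' = - V (A/x + R(x))\<close> are of interest because \<open>V F\<close> is constant
  for every solution \<open>F\<close>; this gives both uniqueness and the invertibility of fundamental
  solutions.
\<close>
lemma dual_solution_from_regular_part:
  assumes x: "x \<in> cut_disc" and D: "matrix_deriv Q D x"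
    and eq: "smat x D = A ** Q x - Q x ** A - smat x (Q x ** matrix_series R x)"
  defines "V \<equiv> \<lambda>x. residue_exp k (- \<kappa> * Ln (\<i> * x)) ** Q x"
  shows "matrix_deriv V (- (V x ** coeff x)) x"
proof -
  have x0: "x \<noteq> 0" using x by (auto simp: cut_disc_def)
  define F where "F = residue_exp k (- \<kappa> * Ln (\<i> * x))"
  have AF: "A ** F = F ** A" unfolding F_def by (rule A_residue_exp_commute)
  have "matrix_deriv V (smat (- 1 / x) (A ** F) ** Q x + F ** D) x"
    unfolding V_def F_def using residue_exp_log_deriv[OF x, of "-1"] by (intro matrix_deriv_mult D) simp
  moreover have "smat (- 1 / x) (A ** F) ** Q x + F ** D = - (V x ** coeff x)"
  proof (rule smat_cancel[OF x0])
    have "smat x (smat (- 1 / x) (A ** F) ** Q x + F ** D) = F ** smat x D - A ** F ** Q x"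
      using x0 by (simp add: matrix_algebra) (simp add: vec_eq_iff)
    also have "\<dots> = - smat x (F ** Q x ** coeff x)"
      unfolding eq coeff_def AF using x0 by (simp add: matrix_algebra matrix_mul_assoc)
    finally show "smat x (smat (- 1 / x) (A ** F) ** Q x + F ** D) = smat x (- (V x ** coeff x))"
      by (simp add: V_def F_def vec_eq_iff)
  qed
  ultimately show ?thesis by simp
qed

text \<open>
  Transposing turns the dual system into one of the original form, with residue \<open>- A\<^sup>T\<close> and
  regular part \<open>- R\<^sup>T\<close>.
\<close>
lemma dual_regular_part:
  obtains Q where "Q 0 = mat 1" "isCont Q 0"
    "\<And>x. norm x * Y < 1 \<Longrightarrow> \<exists>D. matrix_deriv Q D x \<and>
        smat x D = A ** Q x - Q x ** A - smat x (Q x ** matrix_series R x)"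
proof -
  define R' where "R' = (\<lambda>n. - transpose (R n))"
  have bound': "norm (R' n) \<le> (real CARD('n) * (real CARD('n) * K)) * Y ^ n" for n
  proof -
    have "norm (R' n) \<le> real CARD('n) * (real CARD('n) * (K * Y ^ n))"
      unfolding R'_def norm_minus_cancel
      by (rule matrix_norm_le) (auto simp: transpose_def intro: order_trans[OF matrix_entry_norm_le bound])
    thus ?thesis by (simp add: mult_ac)
  qed
  obtain P where P: "matrix_series P 0 = mat 1"
    "\<And>x. norm x * Y < 1 \<Longrightarrow> isCont (matrix_series P) x"
    "\<And>x. norm x * Y < 1 \<Longrightarrow> \<exists>D. matrix_deriv (matrix_series P) D x \<and>
        smat x D = (- transpose A) ** matrix_series P x - matrix_series P x ** (- transpose A)
         + smat x (matrix_series R' x ** matrix_series P x)"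
    by (rule Frobenius_matrix[where A = "- transpose A", OF _ bound' Y]) (erule (1) nonresonant_transpose, blast)
  show ?thesis
  proof (rule that[of "\<lambda>x. transpose (matrix_series P x)"])
    show "transpose (matrix_series P 0) = mat 1" by (simp add: P transpose_mat)
    show "\<exists>D. matrix_deriv (\<lambda>x. transpose (matrix_series P x)) D x \<and>
        smat x D = A ** transpose (matrix_series P x) - transpose (matrix_series P x) ** A
          - smat x (transpose (matrix_series P x) ** matrix_series R x)"
      if x: "norm x * Y < 1" for x
    proof -
      obtain D where D: "matrix_deriv (matrix_series P) D x" and
        eq: "smat x D = (- transpose A) ** matrix_series P x - matrix_series P x ** (- transpose A)
         + smat x (matrix_series R' x ** matrix_series P x)"
        using P(3)[OF x] by blast
      have "matrix_series R' x = - transpose (matrix_series R x)"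
        using matrix_series_sums[OF geometric_bound_summable[OF bound Y norm_ge_zero x], THEN sums_minus]
        by (auto simp: vec_eq_iff matrix_series_def R'_def transpose_def sums_iff)
      hence "transpose (smat x D) = A ** transpose (matrix_series P x) - transpose (matrix_series P x) ** A
          - smat x (transpose (matrix_series P x) ** matrix_series R x)"
        unfolding eq by (simp add: matrix_minus_mult transpose_diff transpose_minus transpose_smat smat_minus
            matrix_transpose_mul flip: minus_smat)
      thus ?thesis using matrix_deriv_transpose[OF D] by (auto simp: transpose_smat)
    qed
    from this[of 0] show "isCont (\<lambda>x. transpose (matrix_series P x)) 0"
      using matrix_deriv_imp_isCont by auto
  qed
qed

lemma det_residue_exp_nz: "det (residue_exp k u) \<noteq> 0"
  using det_mul[of "residue_exp k u" "residue_exp k (- u)"] by (auto simp: residue_exp_inverse det_I)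

lemma cut_disc_lower: "x \<noteq> 0 \<Longrightarrow> Im x \<le> 0 \<Longrightarrow> norm x * Y < 1 \<Longrightarrow> x \<in> cut_disc"
  by (auto simp: cut_disc_def complex_nonpos_Reals_iff complex_eq_iff)

lemma product_constant:
  assumes W: "\<And>x. x \<in> cut_disc \<Longrightarrow> matrix_deriv W (coeff x ** W x) x"
    and V: "\<And>x. x \<in> cut_disc \<Longrightarrow> matrix_deriv V (- (V x ** coeff x)) x"
    and H: "convex H" "open H" "H \<subseteq> cut_disc" "x \<in> H" "y \<in> H"
  shows "V x ** W x = V y ** W y"
proof -
  have "matrix_deriv (\<lambda>x. V x ** W x) 0 z" if "z \<in> H" for z
  proof -
    have "z \<in> cut_disc" using that H by auto
    from matrix_deriv_mult[OF V[OF this] W[OF this]] show ?thesis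
      by (simp add: matrix_minus_mult matrix_mul_assoc)
  qed
  hence "((\<lambda>x. (V x ** W x) $ a $ b) has_field_derivative 0) (at z within H)" if "z \<in> H" for z a b
    using that by (auto simp: matrix_deriv_def intro: has_field_derivative_at_within)
  hence "\<exists>c. \<forall>z\<in>H. (V z ** W z) $ a $ b = c" for a b
    by (intro has_field_derivative_zero_constant[OF H(1)]) auto
  thus ?thesis using H by (metis vec_eq_iff)
qed

text \<open>
  Near \<open>0\<close> the regular parts are close to the identity, so \<open>V\<close> and \<open>W\<close> are invertible there. As
  \<open>V W\<close> is constant on the left half disc, they are invertible on all of it. The last property
  combines \<open>S P(h) S = P(-h)\<close> with the fact that \<open>Ln (\<i> x)\<close> increases by \<open>\<pi> \<i>\<close> from \<open>-h\<close> to \<open>h\<close>.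
\<close>
lemma fundamental_solutions:
  obtains W V where
    "\<And>x. x \<in> cut_disc \<Longrightarrow> matrix_deriv W (coeff x ** W x) x"
    "\<And>x. x \<in> cut_disc \<Longrightarrow> matrix_deriv V (- (V x ** coeff x)) x"
    "\<And>x. norm x * Y < 1 \<Longrightarrow> Re x < 0 \<Longrightarrow> det (V x) \<noteq> 0 \<and> det (W x) \<noteq> 0"
    "\<And>h. h > 0 \<Longrightarrow> h * Y < 1 \<Longrightarrow> S ** W (of_real h) = W (- of_real h) ** S ** residue_exp k (\<kappa> * \<i> * pi)"
proof -
  have SA: "S ** A = A ** S" by (metis S_eq_elt A_eq_elt elt_commute)
  obtain P where P: "matrix_series P 0 = mat 1"
    "\<And>x. norm x * Y < 1 \<Longrightarrow> isCont (matrix_series P) x"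
    "\<And>x. norm x * Y < 1 \<Longrightarrow> \<exists>D. matrix_deriv (matrix_series P) D x \<and>
        smat x D = A ** matrix_series P x - matrix_series P x ** A + smat x (matrix_series R x ** matrix_series P x)"
    "\<And>x. norm x * Y < 1 \<Longrightarrow> S ** matrix_series P x ** S = matrix_series P (-x)"
  proof (rule Frobenius_matrix[where A = A, OF _ bound Y])
    show "X = 0" if "n \<ge> 1" "A ** X - X ** A = smat (of_nat n) X" for n X
      using that by (rule nonresonant)
    fix P assume P: "matrix_series P 0 = mat 1"
      "\<And>x. norm x * Y < 1 \<Longrightarrow> isCont (matrix_series P) x"
      "\<And>x. norm x * Y < 1 \<Longrightarrow> \<exists>D. matrix_deriv (matrix_series P) D x \<and>
        smat x D = A ** matrix_series P x - matrix_series P x ** A + smat x (matrix_series R x ** matrix_series P x)"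
      "\<And>S x. S ** S = mat 1 \<Longrightarrow> S ** A = A ** S \<Longrightarrow> (\<And>n. S ** R n ** S = smat ((-1) ^ Suc n) (R n))
        \<Longrightarrow> norm x * Y < 1 \<Longrightarrow> S ** matrix_series P x ** S = matrix_series P (-x)"
    show thesis by (rule that[of P]) (fact P(1), rule P(2), assumption, rule P(3), assumption, rule P(4)[OF SS SA SR], assumption)
  qed
  obtain Q where Q: "Q 0 = mat 1" "isCont Q 0"
    "\<And>x. norm x * Y < 1 \<Longrightarrow> \<exists>D. matrix_deriv Q D x \<and>
        smat x D = A ** Q x - Q x ** A - smat x (Q x ** matrix_series R x)"
    by (rule dual_regular_part) blast
  define W where "W = (\<lambda>x. matrix_series P x ** residue_exp k (\<kappa> * Ln (\<i> * x)))"
  define V where "V = (\<lambda>x. residue_exp k (- \<kappa> * Ln (\<i> * x)) ** Q x)"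
  have W: "matrix_deriv W (coeff x ** W x) x" if "x \<in> cut_disc" for x
    using P(3)[of x] that solution_from_regular_part[OF that] unfolding W_def by (auto simp: cut_disc_def)
  have V: "matrix_deriv V (- (V x ** coeff x)) x" if "x \<in> cut_disc" for x
    using Q(3)[of x] that dual_solution_from_regular_part[OF that] unfolding V_def by (auto simp: cut_disc_def)
  define H where "H = {x. norm x * Y < 1 \<and> Re x < 0}"
  have H_eq: "H = ball 0 (1 / Y) \<inter> {x. Re x < 0}" using Y by (auto simp: H_def field_simps)
  have H: "convex H" "open H" "H \<subseteq> cut_disc"
    unfolding H_eq by (auto simp: cut_disc_def complex_nonpos_Reals_iff field_simps Y
        intro!: convex_Int convex_halfspace_Re_lt open_halfspace_Re_lt)
  have inv: "det (V x) \<noteq> 0 \<and> det (W x) \<noteq> 0" if x: "norm x * Y < 1" "Re x < 0" for x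
  proof -
    have "isCont (\<lambda>x. det (matrix_series P x) * det (Q x)) 0"
      by (intro continuous_intros isCont_det P Q) simp
    hence "((\<lambda>x. det (matrix_series P x) * det (Q x)) \<longlongrightarrow> 1) (at 0)"
      by (simp add: isCont_def P Q)
    hence "eventually (\<lambda>x. det (matrix_series P x) * det (Q x) \<in> - {0}) (at 0)"
      by (rule topological_tendstoD) auto
    then obtain d where d: "d > 0" "\<And>x. x \<noteq> 0 \<Longrightarrow> norm x < d \<Longrightarrow> det (matrix_series P x) * det (Q x) \<noteq> 0"
      by (auto simp: eventually_at)
    \<comment> \<open>a comparison point \<open>- e\<close> in the left half disc, so close to \<open>0\<close> that the regular parts are invertible there\<close>
    define e where "e = min (d / 2) (1 / (2 * Y))"
    define y where "y = - complex_of_real e"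
    have e: "e > 0" "e < d" "e * Y < 1" using d Y by (auto simp: e_def min_def field_simps)
    hence y: "y \<in> H" "y \<noteq> 0" "norm y < d" by (auto simp: H_def y_def)
    have "V x ** W x = V y ** W y"
      by (rule product_constant[OF W V H]) (use x y in \<open>auto simp: H_def\<close>)
    hence "det (V x) * det (W x) = det (V y) * det (W y)" by (metis det_mul)
    also have "\<dots> \<noteq> 0" using d(2)[OF y(2,3)] by (simp add: V_def W_def det_mul det_residue_exp_nz)
    finally show ?thesis by auto
  qed
  have refl: "S ** W (of_real h) = W (- of_real h) ** S ** residue_exp k (\<kappa> * \<i> * pi)"
    if h: "h > 0" "h * Y < 1" for h :: real
  proof -
    have 1: "Ln (\<i> * of_real h) = of_real (ln h) + \<i> * pi / 2"
      using Ln_times_of_real[OF h(1), of \<i>] h by (simp add: mult.commute Ln_of_real)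
    have 2: "Ln (\<i> * (- of_real h)) = of_real (ln h) - \<i> * pi / 2"
      using Ln_times_of_real[OF h(1), of "-\<i>"] h by (simp add: mult.commute Ln_of_real)
    have log: "\<kappa> * Ln (\<i> * of_real h) = \<kappa> * Ln (\<i> * (- of_real h)) + \<kappa> * \<i> * pi"
      unfolding 1 2 by (simp add: field_simps)
    have "S ** W (of_real h) = (S ** matrix_series P (of_real h) ** S) ** S ** residue_exp k (\<kappa> * Ln (\<i> * of_real h))"
      by (simp add: W_def matrix_mul_assoc) (simp add: SS flip: matrix_mul_assoc)
    also have "S ** matrix_series P (of_real h) ** S = matrix_series P (- of_real h)"
      using P(4)[of "of_real h"] h by simp
    also have "matrix_series P (- of_real h) ** S ** residue_exp k (\<kappa> * Ln (\<i> * of_real h)) =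
        matrix_series P (- of_real h) ** (S ** residue_exp k (\<kappa> * Ln (\<i> * (- of_real h)))) ** residue_exp k (\<kappa> * \<i> * pi)"
      unfolding log residue_exp_add by (simp add: matrix_mul_assoc)
    also have "S ** residue_exp k (\<kappa> * Ln (\<i> * (- of_real h))) = residue_exp k (\<kappa> * Ln (\<i> * (- of_real h))) ** S"
      by (metis S_eq_elt residue_exp_def elt_commute)
    finally show ?thesis by (simp add: W_def matrix_mul_assoc)
  qed
  show ?thesis using that[of W V] W V inv refl by blast
qed

definition line_solution :: "(real \<Rightarrow> complex) \<Rightarrow> (real \<Rightarrow> complex^'n) \<Rightarrow> bool" where
  "line_solution X F \<longleftrightarrow> continuous_on {0..1} F \<and>
     (\<exists>N. finite N \<and> (\<forall>t \<in> {0..1} - N. \<exists>x'. (X has_vector_derivative x') (at t within {0..1}) \<and>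
        (F has_vector_derivative x' *s (coeff (X t) *v F t)) (at t within {0..1})))"

lemma matrix_deriv_along:
  assumes "matrix_deriv W D (X t)" "(X has_vector_derivative x') (at t within T)"
  shows "((\<lambda>t. W (X t) $ a $ b) has_vector_derivative x' * D $ a $ b) (at t within T)"
  using field_vector_diff_chain_within[OF assms(2), of "\<lambda>x. W x $ a $ b" "D $ a $ b"] assms(1)
  by (auto simp: matrix_deriv_def o_def intro: has_field_derivative_at_within)

lemma matrix_deriv_continuous_along:
  assumes "\<And>x. x \<in> U \<Longrightarrow> matrix_deriv W (D x) x" "continuous_on T X" "X ` T \<subseteq> U"
  shows "continuous_on T (\<lambda>t. W (X t))"
  by (rule continuous_on_compose2[OF _ assms(2,3)])
     (auto intro!: continuous_at_imp_continuous_on matrix_deriv_imp_isCont assms(1))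

lemma dual_solution_pairing:
  assumes V: "\<And>x. x \<in> cut_disc \<Longrightarrow> matrix_deriv V (- (V x ** coeff x)) x"
    and X: "continuous_on {0..1} X" "X ` {0..1} \<subseteq> cut_disc"
    and F: "line_solution X F"
  shows "V (X 1) *v F 1 = V (X 0) *v F 0"
proof -
  obtain N where N: "finite N" and der: "\<And>t. t \<in> {0..1} - N \<Longrightarrow> \<exists>x'. (X has_vector_derivative x') (at t within {0..1}) \<and>
        (F has_vector_derivative x' *s (coeff (X t) *v F t)) (at t within {0..1})"
    using F by (auto simp: line_solution_def)
  have contF: "continuous_on {0..1} F" using F by (simp add: line_solution_def)
  have "(V (X 1) *v F 1) $ a = (V (X 0) *v F 0) $ a" for a
  proof (rule has_derivative_zero_unique_strong_interval[OF N])
    have "continuous_on {0..1} (\<lambda>t. V (X t))"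
      by (rule matrix_deriv_continuous_along[OF V X])
    thus "continuous_on {0..1} (\<lambda>t. (V (X t) *v F t) $ a)"
      unfolding matrix_vector_mult_def by (simp, intro continuous_intros contF)
    fix t assume t: "t \<in> {0..1} - N"
    then obtain x' where x': "(X has_vector_derivative x') (at t within {0..1})"
      "(F has_vector_derivative x' *s (coeff (X t) *v F t)) (at t within {0..1})" using der by blast
    have Xt: "X t \<in> cut_disc" using t X by auto
    have F': "((\<lambda>t. F t $ c) has_vector_derivative (x' *s (coeff (X t) *v F t)) $ c) (at t within {0..1})" for c
      by (rule bounded_linear.has_vector_derivative[OF bounded_linear_vec_nth x'(2)])
    have "((\<lambda>t. \<Sum>c\<in>UNIV. V (X t) $ a $ c * F t $ c) has_vector_derivative
        (\<Sum>c\<in>UNIV. V (X t) $ a $ c * (x' *s (coeff (X t) *v F t)) $ c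
          + x' * (- (V (X t) ** coeff (X t))) $ a $ c * F t $ c)) (at t within {0..1})"
      by (intro has_vector_derivative_sum has_vector_derivative_mult F' matrix_deriv_along[OF V[OF Xt] x'(1)])
    also have "(\<lambda>t. \<Sum>c\<in>UNIV. V (X t) $ a $ c * F t $ c) = (\<lambda>t. (V (X t) *v F t) $ a)"
      by (simp add: matrix_vector_mult_def)
    also have "(\<Sum>c\<in>UNIV. V (X t) $ a $ c * (x' *s (coeff (X t) *v F t)) $ c
          + x' * (- (V (X t) ** coeff (X t))) $ a $ c * F t $ c)
        = x' * (V (X t) *v (coeff (X t) *v F t) - (V (X t) ** coeff (X t)) *v F t) $ a"
      by (simp add: matrix_vector_mult_def[of "V (X t)"] matrix_vector_mult_def[of "V (X t) ** coeff (X t)"]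
          sum.distrib sum_distrib_left sum_subtractf right_diff_distrib mult_ac sum_negf)
    also have "\<dots> = 0" by (simp add: matrix_vector_mul_assoc)
    finally show "((\<lambda>t. (V (X t) *v F t) $ a) has_derivative (\<lambda>h. 0)) (at t within {0..1})"
      by (simp add: has_vector_derivative_def)
  qed auto
  thus ?thesis by (simp add: vec_eq_iff)
qed

lemma line_solution_fundamental:
  assumes W: "\<And>x. x \<in> cut_disc \<Longrightarrow> matrix_deriv W (coeff x ** W x) x"
    and X: "continuous_on {0..1} X" "X ` {0..1} \<subseteq> cut_disc"
    and N: "finite N" "\<And>t. t \<in> {0..1} - N \<Longrightarrow> \<exists>x'. (X has_vector_derivative x') (at t within {0..1})"
  shows "line_solution X (\<lambda>t. W (X t) *v c)"
proof -
  have "continuous_on {0..1} (\<lambda>t. W (X t))"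
    by (rule matrix_deriv_continuous_along[OF W X])
  hence "continuous_on {0..1} (\<lambda>t. W (X t) *v c)"
    unfolding matrix_vector_mult_def by (intro continuous_intros)
  moreover have "\<exists>x'. (X has_vector_derivative x') (at t within {0..1}) \<and>
        ((\<lambda>t. W (X t) *v c) has_vector_derivative x' *s (coeff (X t) *v (W (X t) *v c))) (at t within {0..1})"
    if t: "t \<in> {0..1} - N" for t
  proof -
    obtain x' where x': "(X has_vector_derivative x') (at t within {0..1})" using N(2)[OF t] by blast
    have Xt: "X t \<in> cut_disc" using t X by auto
    have "((\<lambda>t. \<Sum>b\<in>UNIV. W (X t) $ a $ b * c $ b) has_vector_derivative
      (\<Sum>b\<in>UNIV. x' * (coeff (X t) ** W (X t)) $ a $ b * c $ b)) (at t within {0..1})" for a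
      by (intro has_vector_derivative_sum has_vector_derivative_mult_left matrix_deriv_along[OF W[OF Xt] x'])
    hence "((\<lambda>t. W (X t) *v c) has_vector_derivative x' *s ((coeff (X t) ** W (X t)) *v c)) (at t within {0..1})"
      by (intro has_vector_derivative_vecI)
         (simp add: matrix_vector_mult_def[of _ c] sum_distrib_left mult_ac)
    thus ?thesis using x' by (auto simp: matrix_vector_mul_assoc)
  qed
  ultimately show ?thesis unfolding line_solution_def using N(1) by blast
qed

text \<open>
  With \<open>W\<close> the fundamental solution, a solution \<open>F\<close> is \<open>W(x) c\<close> with constant \<open>c\<close>. Hence the
  transport followed by \<open>S\<close> is \<open>S W(h) W(-h)\<inverse>\<close>, and \<open>S W(h) = W(-h) S exp(\<pi> \<i> A)\<close>. The
  conjugating matrix \<open>G\<close> is \<open>W(-h)\<close>.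
\<close>
theorem half_turn_monodromy:
  assumes X: "continuous_on {0..1} X" "X ` {0..1} \<subseteq> cut_disc"
    and N: "finite N" "\<And>t. t \<in> {0..1} - N \<Longrightarrow> \<exists>x'. (X has_vector_derivative x') (at t within {0..1})"
    and h: "h > 0" "X 0 = - of_real h" "X 1 = of_real h"
  obtains G G' where "G ** G' = mat 1" "G' ** G = mat 1"
    "\<And>c. \<exists>F. line_solution X F \<and> F 0 = c"
    "\<And>F. line_solution X F \<Longrightarrow> S *v F 1 = (G ** (S ** residue_exp k (\<kappa> * \<i> * pi)) ** G') *v F 0"
proof -
  obtain W V where
    W: "\<And>x. x \<in> cut_disc \<Longrightarrow> matrix_deriv W (coeff x ** W x) x" and
    V: "\<And>x. x \<in> cut_disc \<Longrightarrow> matrix_deriv V (- (V x ** coeff x)) x" and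
    inv: "\<And>x. norm x * Y < 1 \<Longrightarrow> Re x < 0 \<Longrightarrow> det (V x) \<noteq> 0 \<and> det (W x) \<noteq> 0" and
    refl: "\<And>h. h > 0 \<Longrightarrow> h * Y < 1 \<Longrightarrow> S ** W (of_real h) = W (- of_real h) ** S ** residue_exp k (\<kappa> * \<i> * pi)"
    using fundamental_solutions by metis
  have "X 0 \<in> cut_disc" using X by auto
  hence hY: "h * Y < 1" using h by (simp add: cut_disc_def)
  define G where "G = W (X 0)"
  have detG: "det G \<noteq> 0" and detV0: "det (V (X 0)) \<noteq> 0" unfolding G_def using inv[of "X 0"] h hY by auto
  then obtain G' where G': "G ** G' = mat 1" "G' ** G = mat 1"
    using invertible_det_nz[of G] by (auto simp: invertible_def)
  have sol: "line_solution X (\<lambda>t. W (X t) *v c)" for c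
    by (rule line_solution_fundamental[OF W X N])
  have pairing: "V (X 1) *v F 1 = V (X 0) *v F 0" if "line_solution X F" for F
    by (rule dual_solution_pairing[OF _ X that]) (rule V)
  have "V (X 1) ** W (X 1) = V (X 0) ** W (X 0)"
    unfolding matrix_eq using pairing[OF sol] by (simp add: matrix_vector_mul_assoc)
  hence "det (V (X 1)) * det (W (X 1)) = det (V (X 0)) * det G" by (metis det_mul G_def)
  hence "det (V (X 1)) \<noteq> 0" using detG detV0 by auto
  then obtain V' where V': "V' ** V (X 1) = mat 1"
    using invertible_det_nz[of "V (X 1)"] by (auto simp: invertible_def)
  show ?thesis
  proof (rule that[OF G'])
    fix c
    have "W (X 0) *v (G' *v c) = c" using G' by (simp add: G_def matrix_vector_mul_assoc)
    thus "\<exists>F. line_solution X F \<and> F 0 = c" using sol[of "G' *v c"] by blast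
  next
    fix F assume F: "line_solution X F"
    have "W (X 0) *v (G' *v F 0) = F 0" using G' by (simp add: G_def matrix_vector_mul_assoc)
    hence "V (X 1) *v F 1 = V (X 1) *v (W (X 1) *v (G' *v F 0))"
      using pairing[OF F] pairing[OF sol[of "G' *v F 0"]] by simp
    hence "V' *v (V (X 1) *v F 1) = V' *v (V (X 1) *v (W (X 1) *v (G' *v F 0)))" by simp
    hence "F 1 = W (X 1) *v (G' *v F 0)" by (simp add: matrix_vector_mul_assoc V' matrix_mul_assoc)
    thus "S *v F 1 = (G ** (S ** residue_exp k (\<kappa> * \<i> * pi)) ** G') *v F 0"
      using refl[OF h(1) hY] h by (simp add: G_def matrix_vector_mul_assoc matrix_mul_assoc)
  qed
qed

end

section \<open>The dihedral group and its mirrors\<close>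

definition refl_matrix :: "real \<Rightarrow> real^2^2" where
  "refl_matrix \<theta> = vector [vector [cos (2 * \<theta>), sin (2 * \<theta>)], vector [sin (2 * \<theta>), - cos (2 * \<theta>)]]"

definition rot_matrix :: "real \<Rightarrow> real^2^2" where
  "rot_matrix \<phi> = vector [vector [cos \<phi>, - sin \<phi>], vector [sin \<phi>, cos \<phi>]]"

text \<open>The linear form that takes at the direction of angle \<open>\<beta>\<close> the value \<open>sin (\<beta> - \<theta>)\<close>.\<close>
definition line_form :: "real \<Rightarrow> complex^2 \<Rightarrow> complex" where
  "line_form \<theta> x = of_real (cos \<theta>) * x $ 2 - of_real (sin \<theta>) * x $ 1"

definition line_at :: "real \<Rightarrow> (complex^2) set" where
  "line_at \<theta> = {x. line_form \<theta> x = 0}"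

lemma reflection_eq: "reflection m i = refl_matrix (mirror_angle m i)"
  by (simp add: reflection_def refl_matrix_def Let_def)

lemma rotation_eq: "rotation m j = rot_matrix (2 * mirror_angle m j)"
  by (simp add: rotation_def rot_matrix_def Let_def mirror_angle_def mult_ac)

lemma cvec_nth [simp]: "cvec x $ a = of_real (x $ a)"
  by (simp add: cvec_def)

lemma direction_nth [simp]: "direction \<theta> $ 1 = cos \<theta>" "direction \<theta> $ 2 = sin \<theta>"
  by (simp_all add: direction_def)

lemma mirror_eq_line: "mirror m i = line_at (mirror_angle m i)"
proof -
  define \<theta> where "\<theta> = mirror_angle m i"
  have "x \<in> range (\<lambda>c. c *s cvec (direction \<theta>))" if "line_form \<theta> x = 0" for x
  proof -
    have eq: "of_real (cos \<theta>) * x $ 2 = of_real (sin \<theta>) * x $ 1" using that by (simp add: line_form_def)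
    have one: "of_real (cos \<theta>) * of_real (cos \<theta>) + of_real (sin \<theta>) * of_real (sin \<theta>) = (1 :: complex)"
      by (metis of_real_1 of_real_add of_real_mult power2_eq_square sin_cos_squared_add2)
    define c where "c = x $ 1 * of_real (cos \<theta>) + x $ 2 * of_real (sin \<theta>)"
    have "c * of_real (cos \<theta>) = x $ 1 * (of_real (cos \<theta>) * of_real (cos \<theta>)) + (of_real (cos \<theta>) * x $ 2) * of_real (sin \<theta>)"
      by (simp add: c_def algebra_simps)
    also have "\<dots> = x $ 1 * (of_real (cos \<theta>) * of_real (cos \<theta>) + of_real (sin \<theta>) * of_real (sin \<theta>))"
      unfolding eq by (simp add: algebra_simps)
    finally have 1: "c * of_real (cos \<theta>) = x $ 1" unfolding one by simp
    have "c * of_real (sin \<theta>) = x $ 2 * (of_real (sin \<theta>) * of_real (sin \<theta>)) + (of_real (sin \<theta>) * x $ 1) * of_real (cos \<theta>)"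
      by (simp add: c_def algebra_simps)
    also have "\<dots> = x $ 2 * (of_real (cos \<theta>) * of_real (cos \<theta>) + of_real (sin \<theta>) * of_real (sin \<theta>))"
      unfolding eq[symmetric] by (simp add: algebra_simps)
    finally have 2: "c * of_real (sin \<theta>) = x $ 2" unfolding one by simp
    have "x = c *s cvec (direction \<theta>)" by (simp add: vec_eq_iff forall_2 1 2)
    thus ?thesis by blast
  qed
  thus ?thesis
    unfolding mirror_def line_at_def \<theta>_def[symmetric] by (auto simp: line_form_def)
qed

lemma line_form_linear: "line_form \<theta> (x + y) = line_form \<theta> x + line_form \<theta> y"
   "line_form \<theta> (c *s x) = c * line_form \<theta> x"
  by (simp_all add: line_form_def algebra_simps)

lemma line_form_direction: "line_form \<theta> (cvec (c *\<^sub>R direction \<beta>)) = of_real (c * sin (\<beta> - \<theta>))"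
  by (simp add: line_form_def sin_diff algebra_simps)

lemma line_at_add_pi: "line_at (\<theta> + of_int n * pi) = line_at \<theta>"
proof -
  have s: "sin (of_int n * pi) = 0" by (simp add: sin_zero_iff_int2)
  hence "cos (of_int n * pi) \<noteq> 0" by (metis one_neq_zero sin_cos_squared_add power_zero_numeral add_0)
  moreover have "line_form (\<theta> + of_int n * pi) x = of_real (cos (of_int n * pi)) * line_form \<theta> x" for x
    by (simp add: line_form_def sin_add cos_add s algebra_simps)
  ultimately show ?thesis by (simp add: line_at_def)
qed

lemma refl_matrix_add_pi: "refl_matrix (\<theta> + of_int n * pi) = refl_matrix \<theta>"
  and rot_matrix_add_2pi: "rot_matrix (\<theta> + of_int n * (2 * pi)) = rot_matrix \<theta>"
proof -
  have "cos (\<psi> + of_int n * (2 * pi)) = cos \<psi>" "sin (\<psi> + of_int n * (2 * pi)) = sin \<psi>" for \<psi>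
    using sin_int_2pin[of n] cos_int_2pin[of n] by (simp_all add: cos_add sin_add mult_ac)
  note this[of "2 * \<theta>"] this[of \<theta>]
  thus "refl_matrix (\<theta> + of_int n * pi) = refl_matrix \<theta>" "rot_matrix (\<theta> + of_int n * (2 * pi)) = rot_matrix \<theta>"
    by (simp_all add: refl_matrix_def rot_matrix_def algebra_simps)
qed

text \<open>
  Lines and reflections depend on their angle modulo \<open>\<pi>\<close>, so an arbitrary integer multiple of
  \<open>\<pi>/m\<close> can be reduced to an index below \<open>m\<close>.
\<close>
lemma mirror_angle_mod:
  assumes "m > 0"
  obtains n where "of_int l * pi / real m = mirror_angle m (nat (l mod int m)) + of_int n * pi"
proof
  have "real_of_int l = of_int (l div int m) * real m + of_int (l mod int m)"
    by (metis div_mult_mod_eq of_int_add of_int_mult of_int_of_nat_eq)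
  moreover have "real (nat (l mod int m)) = of_int (l mod int m)" using assms by simp
  ultimately show "of_int l * pi / real m = mirror_angle m (nat (l mod int m)) + of_int (l div int m) * pi"
    using assms by (simp add: mirror_angle_def add_divide_distrib diff_divide_distrib algebra_simps)
qed

lemma line_at_eq_mirror:
  assumes "m > 0"
  shows "line_at (of_int l * pi / real m) = mirror m (nat (l mod int m))"
  using mirror_angle_mod[OF assms, of l] line_at_add_pi mirror_eq_line by metis

lemma refl_matrix_eq_reflection:
  assumes "m > 0"
  shows "refl_matrix (of_int l * pi / real m) = reflection m (nat (l mod int m))"
  using mirror_angle_mod[OF assms, of l] refl_matrix_add_pi reflection_eq by metis

lemma rot_matrix_eq_rotation:
  assumes "m > 0"
  shows "rot_matrix (2 * (of_int l * pi / real m)) = rotation m (nat (l mod int m))"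
proof -
  obtain n where n: "of_int l * pi / real m = mirror_angle m (nat (l mod int m)) + of_int n * pi"
    using mirror_angle_mod[OF assms] by blast
  show ?thesis
    using rot_matrix_add_2pi[of "2 * mirror_angle m (nat (l mod int m))" n] unfolding n rotation_eq
    by (simp add: algebra_simps)
qed

lemma line_at_inj: 
  assumes "line_at \<theta> = line_at \<phi>" shows "sin (\<theta> - \<phi>) = 0"
proof -
  have form: "line_form \<beta> (cvec (direction \<theta>)) = of_real (sin (\<theta> - \<beta>))" for \<beta>
    using line_form_direction[of \<beta> 1 \<theta>] by simp
  have "cvec (direction \<theta>) \<in> line_at \<theta>" by (simp add: line_at_def form)
  hence "line_form \<phi> (cvec (direction \<theta>)) = 0" using assms unfolding line_at_def by blast
  thus ?thesis using form[of \<phi>] by (simp only: of_real_eq_0_iff)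
qed

lemma mirror_angle_diff_bounds:
  assumes "i < m" "j < m" "i \<noteq> j"
  shows "pi / real m \<le> \<bar>mirror_angle m i - mirror_angle m j\<bar>" "\<bar>mirror_angle m i - mirror_angle m j\<bar> \<le> pi - pi / real m"
proof -
  have eq: "\<bar>mirror_angle m i - mirror_angle m j\<bar> = \<bar>real i - real j\<bar> * (pi / real m)"
    by (simp add: mirror_angle_def abs_mult flip: left_diff_distrib diff_divide_distrib)
  have "1 \<le> \<bar>real i - real j\<bar>" "\<bar>real i - real j\<bar> \<le> real m - 1" using assms by auto
  from this[THEN mult_right_mono, of "pi / real m"]
  show "pi / real m \<le> \<bar>mirror_angle m i - mirror_angle m j\<bar>" "\<bar>mirror_angle m i - mirror_angle m j\<bar> \<le> pi - pi / real m"
    unfolding eq using assms by (simp_all add: field_simps)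
qed

lemma mirror_inj:
  assumes "i < m" "j < m" "mirror m i = mirror m j" shows "i = j"
proof (rule ccontr)
  assume ne: "i \<noteq> j"
  define \<psi> where "\<psi> = mirror_angle m i - mirror_angle m j"
  have "sin \<psi> = 0" using line_at_inj assms(3) by (simp add: mirror_eq_line \<psi>_def)
  hence "sin \<bar>\<psi>\<bar> = 0" by (simp add: abs_if)
  moreover have "0 < pi / real m" using assms by simp
  hence "0 < \<bar>\<psi>\<bar>" "\<bar>\<psi>\<bar> < pi" using mirror_angle_diff_bounds[OF assms(1,2) ne] unfolding \<psi>_def by linarith+
  ultimately show False using sin_gt_zero[of "\<bar>\<psi>\<bar>"] by simp
qed

lemma cact_mult: "cact (w ** w') x = cact w (cact w' x)"
proof -
  have "map_matrix complex_of_real (w ** w') = map_matrix complex_of_real w ** map_matrix complex_of_real w'"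
    by (simp add: vec_eq_iff matrix_matrix_mult_def map_matrix_def)
  thus ?thesis by (simp add: cact_def matrix_vector_mul_assoc)
qed

lemma cact_one [simp]: "cact (mat 1) x = x"
proof -
  have "map_matrix complex_of_real (mat 1 :: real^2^2) = mat 1"
    by (simp add: vec_eq_iff map_matrix_def mat_def)
  thus ?thesis by (simp add: cact_def)
qed

lemma cact_cvec: "cact w (cvec x) = cvec (w *v x)"
  by (simp add: cact_def vec_eq_iff matrix_vector_mult_def map_matrix_def)

lemma refl_direction: "refl_matrix \<theta> *v direction \<phi> = direction (2 * \<theta> - \<phi>)"
  by (simp add: vec_eq_iff forall_2 refl_matrix_def matrix_vector_mult_def sum_2 cos_diff sin_diff)

lemma rot_direction: "rot_matrix \<psi> *v direction \<phi> = direction (\<phi> + \<psi>)"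
  by (simp add: vec_eq_iff forall_2 rot_matrix_def matrix_vector_mult_def sum_2 cos_add sin_add)

lemma refl_refl: "refl_matrix \<theta> ** refl_matrix \<phi> = rot_matrix (2 * (\<theta> - \<phi>))"
  and rot_refl: "rot_matrix (2 * \<theta>) ** refl_matrix \<phi> = refl_matrix (\<theta> + \<phi>)"
  by (simp_all add: vec_eq_iff forall_2 refl_matrix_def rot_matrix_def matrix_matrix_mult_def sum_2
      cos_diff sin_diff cos_add sin_add distrib_left right_diff_distrib)

lemma rot_zero: "rot_matrix 0 = mat 1"
  by (simp add: vec_eq_iff forall_2 rot_matrix_def mat_def)

lemma cact_refl_line: "cact (refl_matrix \<theta>) ` line_at \<phi> = line_at (2 * \<theta> - \<phi>)"
proof -
  have form: "line_form (2 * \<theta> - \<phi>) (cact (refl_matrix \<theta>) x) = - line_form \<phi> x" for \<phi> x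
  proof -
    have "cos (2 * \<theta> - \<phi>) * sin (2 * \<theta>) - sin (2 * \<theta> - \<phi>) * cos (2 * \<theta>) = sin \<phi>"
      "cos (2 * \<theta> - \<phi>) * cos (2 * \<theta>) + sin (2 * \<theta> - \<phi>) * sin (2 * \<theta>) = cos \<phi>"
      using sin_diff[of "2 * \<theta>" "2 * \<theta> - \<phi>"] cos_diff[of "2 * \<theta> - \<phi>" "2 * \<theta>"] by (simp_all add: mult_ac)
    hence "complex_of_real (cos (2 * \<theta> - \<phi>) * sin (2 * \<theta>) - sin (2 * \<theta> - \<phi>) * cos (2 * \<theta>)) = of_real (sin \<phi>)"
      "complex_of_real (cos (2 * \<theta> - \<phi>) * cos (2 * \<theta>) + sin (2 * \<theta> - \<phi>) * sin (2 * \<theta>)) = of_real (cos \<phi>)"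
      by (simp_all only:)
    note eqs = this[symmetric]
    show ?thesis
      unfolding line_form_def[of \<phi>] eqs 
      by (simp add: line_form_def[of "2 * \<theta> - \<phi>"] cact_def refl_matrix_def matrix_vector_mult_def sum_2 map_matrix_def)
         (simp add: algebra_simps)
  qed
  have inv: "cact (refl_matrix \<theta>) (cact (refl_matrix \<theta>) x) = x" for x
    using cact_mult[of "refl_matrix \<theta>" "refl_matrix \<theta>" x] by (simp add: refl_refl rot_zero)
  show ?thesis
    using form[of \<phi>] form[of "2 * \<theta> - \<phi>"] inv by (auto simp: line_at_def image_iff) (metis neg_equal_0_iff_equal)
qed

text \<open>Every rotation is a product of two reflections.\<close>
lemma cact_rot_line: "cact (rot_matrix \<psi>) ` line_at \<phi> = line_at (\<phi> + \<psi>)"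
proof -
  have "rot_matrix \<psi> = refl_matrix (\<psi> / 2) ** refl_matrix 0" by (simp add: refl_refl)
  hence "cact (rot_matrix \<psi>) ` line_at \<phi> = cact (refl_matrix (\<psi> / 2)) ` cact (refl_matrix 0) ` line_at \<phi>"
    by (simp add: cact_mult image_image)
  thus ?thesis by (simp add: cact_refl_line add.commute)
qed

lemma act_index_eq:
  assumes "j < m" "cact w ` mirror m i = mirror m j"
  shows "act_index m w i = j"
  unfolding act_index_def by (rule the_equality) (use assms mirror_inj in auto)

lemma reflection_mirror:
  assumes "m > 0"
  shows "cact (reflection m i) ` mirror m j = mirror m (nat ((2 * int i - int j) mod int m))"
proof -
  have "2 * mirror_angle m i - mirror_angle m j = of_int (2 * int i - int j) * pi / real m"
    by (simp add: mirror_angle_def add_divide_distrib diff_divide_distrib algebra_simps)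
  thus ?thesis
    unfolding reflection_eq mirror_eq_line[of m j] cact_refl_line by (simp only: line_at_eq_mirror[OF assms])
qed

lemma rotation_mirror:
  assumes "m > 0"
  shows "cact (rotation m i) ` mirror m j = mirror m (nat ((2 * int i + int j) mod int m))"
proof -
  have "mirror_angle m j + 2 * mirror_angle m i = of_int (2 * int i + int j) * pi / real m"
    by (simp add: mirror_angle_def add_divide_distrib diff_divide_distrib algebra_simps)
  thus ?thesis
    unfolding rotation_eq mirror_eq_line[of m j] cact_rot_line by (simp only: line_at_eq_mirror[OF assms])
qed

lemma act_index_reflection:
  assumes "m > 0"
  shows "act_index m (reflection m i) j = nat ((2 * int i - int j) mod int m)"
  by (rule act_index_eq[OF _ reflection_mirror[OF assms]]) (use assms in \<open>simp add: nat_less_iff\<close>)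

lemma reflection_in_dihedral: "i < m \<Longrightarrow> reflection m i \<in> dihedral m"
  and one_in_dihedral: "m > 0 \<Longrightarrow> mat 1 \<in> dihedral m"
proof -
  show "i < m \<Longrightarrow> reflection m i \<in> dihedral m" by (simp add: dihedral_def)
  have "rotation m 0 = mat 1" by (simp add: rotation_eq mirror_angle_def rot_zero)
  thus "m > 0 \<Longrightarrow> mat 1 \<in> dihedral m" unfolding dihedral_def by (metis UnI1 imageI lessThan_iff)
qed

lemma dihedral_permutes_mirrors:
  assumes "m > 0" "w \<in> dihedral m"
  shows "act_index m w i < m" "cact w ` mirror m i = mirror m (act_index m w i)"
proof -
  obtain l where l: "cact w ` mirror m i = mirror m (nat (l mod int m))"
    using assms reflection_mirror rotation_mirror by (auto simp: dihedral_def)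
  moreover have lt: "nat (l mod int m) < m" using assms by (simp add: nat_less_iff)
  ultimately have "act_index m w i = nat (l mod int m)" by (intro act_index_eq)
  with l lt show "act_index m w i < m" "cact w ` mirror m i = mirror m (act_index m w i)" by simp_all
qed

lemma dihedral_mult_reflection:
  assumes "m > 0" "w \<in> dihedral m"
  shows "w ** reflection m i \<in> dihedral m"
proof -
  have lt: "nat (l mod int m) < m" for l using assms by (simp add: nat_less_iff)
  from assms(2) consider j where "w = rotation m j" | j where "w = reflection m j" by (auto simp: dihedral_def)
  thus ?thesis
  proof cases
    case 1
    have "mirror_angle m j + mirror_angle m i = of_int (int j + int i) * pi / real m"
      by (simp add: mirror_angle_def add_divide_distrib diff_divide_distrib algebra_simps)
    hence "w ** reflection m i = reflection m (nat ((int j + int i) mod int m))"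
      unfolding 1 rotation_eq reflection_eq[of m i] rot_refl by (simp only: refl_matrix_eq_reflection[OF assms(1)])
    thus ?thesis using lt by (auto simp: dihedral_def)
  next
    case 2
    have "mirror_angle m j - mirror_angle m i = of_int (int j - int i) * pi / real m"
      by (simp add: mirror_angle_def add_divide_distrib diff_divide_distrib algebra_simps)
    hence "w ** reflection m i = rotation m (nat ((int j - int i) mod int m))"
      unfolding 2 reflection_eq refl_refl by (simp only: rot_matrix_eq_rotation[OF assms(1)])
    thus ?thesis using lt by (auto simp: dihedral_def)
  qed
qed

lemma act_index_mult:
  assumes "m > 0" "w \<in> dihedral m" "w' \<in> dihedral m"
  shows "act_index m (w ** w') i = act_index m w (act_index m w' i)"
proof (rule act_index_eq)
  have "cact (w ** w') ` mirror m i = cact w ` cact w' ` mirror m i" by (simp add: cact_mult image_image)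
  thus "cact (w ** w') ` mirror m i = mirror m (act_index m w (act_index m w' i))"
    by (simp add: dihedral_permutes_mirrors(2)[OF assms(1)] assms)
qed (rule dihedral_permutes_mirrors(1)[OF assms(1,2)])

lemma act_index_one: "i < m \<Longrightarrow> act_index m (mat 1) i = i"
  by (rule act_index_eq) auto

lemma reflection_involution: "reflection m i ** reflection m i = mat 1"
  by (simp add: reflection_eq refl_refl rot_zero)

lemma iota_mult:
  fixes lab :: "'n::finite \<Rightarrow> nat"
  assumes lab: "bij_betw lab UNIV {..<m}" and m: "m > 0" and w: "w \<in> dihedral m" "w' \<in> dihedral m"
  shows "iota m lab (w ** w') = iota m lab w ** iota m lab w'"
proof -
  have "(iota m lab w ** iota m lab w') $ a $ b = iota m lab (w ** w') $ a $ b" for a b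
  proof -
    obtain c where c: "lab c = act_index m w' (lab b)"
      using lab dihedral_permutes_mirrors(1)[OF m w(2), of "lab b"] unfolding bij_betw_def
      by (metis imageE lessThan_iff)
    have c_iff: "lab c' = act_index m w' (lab b) \<longleftrightarrow> c' = c" for c'
      using lab c by (metis bij_betw_def injD)
    have "(iota m lab w ** iota m lab w') $ a $ b = (\<Sum>k\<in>UNIV. (if lab a = act_index m w (lab k) then 1 else 0) *
        (if lab k = act_index m w' (lab b) then 1 else 0))"
      by (simp add: matrix_matrix_mult_def iota_def)
    also have "\<dots> = (\<Sum>k\<in>UNIV. if k = c then if lab a = act_index m w (lab c) then 1 else 0 else 0)"
      unfolding c_iff by (intro sum.cong) auto
    finally have "(iota m lab w ** iota m lab w') $ a $ b = (if lab a = act_index m w (lab c) then 1 else 0)"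
      by simp
    thus ?thesis using c by (simp add: iota_def act_index_mult[OF m w])
  qed
  thus ?thesis by (simp add: vec_eq_iff)
qed

lemma iota_one:
  fixes lab :: "'n::finite \<Rightarrow> nat"
  assumes lab: "bij_betw lab UNIV {..<m}"
  shows "iota m lab (mat 1) = mat 1"
proof -
  have "lab b < m" for b using lab by (auto simp: bij_betw_def)
  moreover have "lab a = lab b \<longleftrightarrow> a = b" for a b using lab by (metis bij_betw_def injD)
  ultimately show ?thesis by (simp add: iota_def act_index_one) (simp add: vec_eq_iff mat_def)
qed

section \<open>The path around the mirror\<close>

text \<open>
  The path of a braid generator in the coordinate \<open>x\<close> centred at the mirror: along the real axis
  up to \<open>r - 1/2 < 0\<close>, then counterclockwise around \<open>0\<close>, through the lower half plane, and on
  along the real axis.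
\<close>
definition detour :: "real \<Rightarrow> real \<Rightarrow> complex" where
  "detour r = linepath (-1/2) (of_real r - 1/2) +++ (\<lambda>t. (of_real r - 1/2) * exp (of_real (pi * t) * \<i>)) +++
     linepath (1/2 - of_real r) (1/2)"

lemma valid_path_detour: "valid_path (detour r)"
proof -
  let ?g = "\<lambda>t. (of_real r - 1/2) * exp (of_real (pi * t) * \<i>)"
  have "(?g has_vector_derivative (of_real r - 1/2) * (exp (of_real (pi * t) * \<i>) * (of_real pi * \<i>))) (at t)" for t
  proof -
    have "((\<lambda>z. (of_real r - 1/2) * exp (of_real pi * z * \<i>)) has_field_derivative
        (of_real r - 1/2) * (exp (of_real (pi * t) * \<i>) * (of_real pi * \<i>))) (at (of_real t))"
      by (auto intro!: derivative_eq_intros)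
    from has_vector_derivative_real_field[OF this] show ?thesis by simp
  qed
  hence "valid_path ?g"
    unfolding valid_path_def
    by (intro C1_differentiable_imp_piecewise, unfold C1_differentiable_on_def)
       (intro exI[of _ "\<lambda>t. (of_real r - 1/2) * (exp (of_real (pi * t) * \<i>) * (of_real pi * \<i>))"] conjI ballI continuous_intros)
  thus ?thesis
    unfolding detour_def
    by (intro valid_path_join valid_path_linepath) (auto simp: pathfinish_def pathstart_def linepath_def joinpaths_def)
qed

lemma detour_ends: "detour r 0 = -1/2" "detour r 1 = 1/2"
  by (simp_all add: detour_def joinpaths_def linepath_def)

lemma detour_range:
  assumes r: "0 < r" "r < 1 / 2" and t: "t \<in> {0..1}"
  shows "detour r t \<noteq> 0" "Im (detour r t) \<le> 0" "norm (detour r t) \<le> 1 / 2"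
proof -
  let ?g = "\<lambda>t. (of_real r - 1/2) * exp (of_real (pi * t) * \<i>)"
  have 1: "x \<noteq> 0 \<and> Im x \<le> 0 \<and> norm x \<le> 1 / 2" if x: "x \<in> path_image (linepath (-1/2) (of_real r - 1/2 :: complex))" for x
  proof -
    obtain s where s: "s \<in> {0..1}" "x = of_real (s * r - 1/2)"
    proof -
      obtain s where "s \<in> {0..1}" "x = linepath (-1/2) (of_real r - 1/2) s" using x by (auto simp: path_image_def)
      thus ?thesis by (intro that[of s]) (auto simp: linepath_def scaleR_conv_of_real[where 'a=complex] field_simps)
    qed
    define u where "u = s * r"
    have "0 \<le> u" "u \<le> 1 * r" unfolding u_def using s r by (auto intro!: mult_right_mono simp del: mult_1)
    moreover have "x = of_real (u - 1/2)" by (simp add: s u_def)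
    ultimately show ?thesis using r by (simp only: of_real_eq_0_iff norm_of_real Im_complex_of_real) auto
  qed
  have 2: "x \<noteq> 0 \<and> Im x \<le> 0 \<and> norm x \<le> 1 / 2" if x: "x \<in> path_image (linepath (1/2 - of_real r) (1/2 :: complex))" for x
  proof -
    obtain s where s: "s \<in> {0..1}" "x = of_real (1/2 - (1 - s) * r)"
    proof -
      obtain s where "s \<in> {0..1}" "x = linepath (1/2 - of_real r) (1/2) s" using x by (auto simp: path_image_def)
      thus ?thesis by (intro that[of s]) (auto simp: linepath_def scaleR_conv_of_real[where 'a=complex] field_simps)
    qed
    define u where "u = (1 - s) * r"
    have "0 \<le> u" "u \<le> 1 * r" unfolding u_def using s r by (auto intro!: mult_right_mono simp del: mult_1)
    moreover have "x = of_real (1/2 - u)" by (simp add: s u_def)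
    ultimately show ?thesis using r by (simp only: of_real_eq_0_iff norm_of_real Im_complex_of_real) auto
  qed
  have 3: "x \<noteq> 0 \<and> Im x \<le> 0 \<and> norm x \<le> 1 / 2" if x: "x \<in> path_image ?g" for x
  proof -
    obtain s where s: "s \<in> {0..1}" "x = of_real (r - 1/2) * exp (of_real (pi * s) * \<i>)"
      using x by (auto simp: path_image_def)
    have "Im x = (r - 1/2) * sin (pi * s)"
      unfolding s(2) by (simp add: Im_exp del: of_real_diff)
    moreover have "sin (pi * s) \<ge> 0" using s by (intro sin_ge_zero) auto
    moreover have "norm x = 1/2 - r" unfolding s(2) norm_mult norm_of_real using r by simp
    ultimately show ?thesis using r by (auto intro: mult_nonpos_nonneg)
  qed
  have "detour r t \<in> path_image (detour r)" using t by (auto simp: path_image_def)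
  also have "\<dots> \<subseteq> path_image (linepath (-1/2) (of_real r - 1/2)) \<union> (path_image ?g \<union> path_image (linepath (1/2 - of_real r) (1/2)))"
    unfolding detour_def by (intro order_trans[OF path_image_join_subset] Un_mono order_refl path_image_join_subset)
  finally show "detour r t \<noteq> 0" "Im (detour r t) \<le> 0" "norm (detour r t) \<le> 1 / 2"
    using 1 2 3 by blast+
qed

text \<open>
  The difference of the squares of both sides is \<open>sin (\<psi> + \<phi>) sin (\<psi> - \<phi>)\<close>. For \<open>\<psi> > 0\<close> both
  arguments lie in \<open>(0, \<pi>)\<close>, for \<open>\<psi> < 0\<close> both lie in \<open>(- \<pi>, 0)\<close>.
\<close>
lemma abs_tan_cot_less_one:
  assumes \<phi>: "\<bar>\<phi>\<bar> < d" and \<psi>: "d \<le> \<bar>\<psi>\<bar>" "\<bar>\<psi>\<bar> \<le> pi - d" and d: "d \<le> pi / 3"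
  shows "\<bar>cos \<psi> * sin \<phi>\<bar> < \<bar>sin \<psi> * cos \<phi>\<bar>"
proof -
  have pos: "0 < sin (\<psi>' + \<phi>) * sin (\<psi>' - \<phi>)" if "d \<le> \<psi>'" "\<psi>' \<le> pi - d" for \<psi>'
    using that \<phi> by (intro mult_pos_pos sin_gt_zero) (auto simp: abs_if split: if_splits)
  have "0 < sin (\<psi> + \<phi>) * sin (\<psi> - \<phi>)"
  proof (cases "\<psi> \<ge> 0")
    case True
    thus ?thesis using pos[of \<psi>] \<psi> by simp
  next
    case False
    have "sin (- \<psi> + \<phi>) * sin (- \<psi> - \<phi>) = sin (\<psi> + \<phi>) * sin (\<psi> - \<phi>)"
    proof -
      have "sin (- \<psi> + \<phi>) = - sin (\<psi> - \<phi>)" "sin (- \<psi> - \<phi>) = - sin (\<psi> + \<phi>)"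
        by (simp_all add: sin_add sin_diff)
      thus ?thesis by simp
    qed
    thus ?thesis using False pos[of "- \<psi>"] \<psi> by simp
  qed
  also have "sin (\<psi> + \<phi>) * sin (\<psi> - \<phi>) = (sin \<psi> * cos \<phi>)\<^sup>2 - (cos \<psi> * sin \<phi>)\<^sup>2"
    by (simp add: sin_add sin_diff power2_eq_square algebra_simps)
  finally show ?thesis by (simp add: abs_le_square_iff[symmetric] flip: not_le)
qed

lemma has_vector_derivative_vector_scale:
  fixes X :: "real \<Rightarrow> complex"
  assumes "(X has_vector_derivative x') (at t within T)"
  shows "((\<lambda>t. b + X t *s a) has_vector_derivative x' *s a) (at t within T)"
  by (rule has_vector_derivative_vecI) (auto intro!: derivative_eq_intros assms)

lemma rank_outer_product:
  fixes A :: "complex^'n^'n"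
  assumes A: "\<And>a b. A $ a $ b = x $ a * y $ b" and "x \<noteq> 0" "y \<noteq> 0"
  shows "rank A = 1"
proof -
  have row: "row a A = x $ a *s y" for a by (simp add: row_def A vec_eq_iff)
  have "vec.span (rows A) = vec.span {y}"
  proof
    show "vec.span (rows A) \<subseteq> vec.span {y}"
      by (rule vec.span_minimal) (auto simp: rows_def row vec.span_base vec.span_scale)
    obtain a where a: "x $ a \<noteq> 0" using \<open>x \<noteq> 0\<close> by (auto simp: vec_eq_iff)
    have "y = inverse (x $ a) *s row a A" using a by (simp add: row)
    hence "y \<in> vec.span (rows A)" by (metis (mono_tags, lifting) vec.span_base vec.span_scale rows_def mem_Collect_eq UNIV_I)
    thus "vec.span {y} \<subseteq> vec.span (rows A)" by (intro vec.span_minimal) auto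
  qed
  hence "vec.dim (rows A) = vec.dim {y}" by (metis vec.dim_span)
  also have "\<dots> = 1" using \<open>y \<noteq> 0\<close> by (subst vec.dim_eq_card_independent) auto
  finally show ?thesis by (simp add: row_rank_def_gen)
qed

section \<open>The connection along a braid generator\<close>

text \<open>
  The data of one generator \<open>\<sigma>\<^sub>i\<close>. The base point is \<open>c \<cdot> direction \<beta>\<close>, in one of the two
  sectors adjacent to the mirror of index \<open>i\<close>; for the sector between the mirrors \<open>0\<close> and \<open>1\<close>
  this holds with \<open>i = 0\<close> and with \<open>i = 1\<close>.
\<close>
locale braid_generator =
  fixes m :: nat and lab :: "'n::finite \<Rightarrow> nat" and f :: "nat \<Rightarrow> complex^2 \<Rightarrow> complex" and k \<alpha> \<kappa> :: complex
    and i :: nat and c \<beta> r :: real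
  assumes m: "m \<ge> 3" and lab: "bij_betw lab UNIV {..<m}" and k: "k \<noteq> 0"
    and f_linear: "\<And>j. j < m \<Longrightarrow> Vector_Spaces.linear (*s) (*) (f j)"
    and f_kernel: "\<And>j. j < m \<Longrightarrow> {x. f j x = 0} = mirror m j"
    and i: "i < m" and c: "c > 0"
    and sector: "\<beta> \<noteq> mirror_angle m i" "\<bar>\<beta> - mirror_angle m i\<bar> < pi / m"
    and r: "0 < r" "r < 1 / 2"
    and nonresonant_params: "\<And>n::int. n \<noteq> 0 \<Longrightarrow> 2 * \<kappa> * k \<noteq> of_int n \<and> \<kappa> * \<alpha> \<noteq> of_int n \<and> \<kappa> * (2 * k - \<alpha>) \<noteq> of_int n"
begin

text \<open>
  \<open>\<tau>\<close> is the action of \<open>s\<^sub>i\<close> on mirrors. The mirror of index \<open>j \<in> I\<close> meets the line of the path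
  where \<open>y j \<cdot> x = 1\<close>. Working with \<open>y j\<close> instead of the coordinate of the intersection covers a
  mirror parallel to the line. \<open>R n\<close> are the coefficients of \<open>\<Sum>j\<in>I. - \<kappa> y\<^sub>j / (1 - y\<^sub>j x) B\<^sub>j\<close>,
  and \<open>1/Y\<close> bounds their radius of convergence from below.
\<close>
definition "S = (iota m lab (reflection m i) :: complex^'n^'n)"
definition "B j = (smat k (iota m lab (reflection m j)) - proj_mat lab k \<alpha> j :: complex^'n^'n)"
definition "\<tau> j = act_index m (reflection m i) j"
definition "\<phi> = \<beta> - mirror_angle m i"
definition "\<psi> j = mirror_angle m i - mirror_angle m j"
definition "y j = 2 * cos (\<psi> j) * sin \<phi> / (sin (\<psi> j) * cos \<phi>)"
definition "I = {..<m} - {i}"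
definition "R n = (\<Sum>j\<in>I. smat (- \<kappa> * of_real (y j) ^ Suc n) (B j))"
definition "Y = Max (insert 1 ((\<lambda>j. \<bar>y j\<bar>) ` I))"

lemma m0: "m > 0" using m by simp

lemma lab_lt: "lab a < m" using lab by (auto simp: bij_betw_def)
lemma lab_eq_iff: "lab a = lab b \<longleftrightarrow> a = b" using lab by (metis bij_betw_def injD)
lemma lab_surj: "j < m \<Longrightarrow> \<exists>a. lab a = j" using lab unfolding bij_betw_def by (metis imageE lessThan_iff)

lemma \<tau>_eq: "\<tau> j = nat ((2 * int i - int j) mod int m)"
  by (simp add: \<tau>_def act_index_reflection[OF m0])

lemma \<tau>_lt: "\<tau> j < m" using m0 by (simp add: \<tau>_eq nat_less_iff)

lemma \<tau>_\<tau>: "j < m \<Longrightarrow> \<tau> (\<tau> j) = j"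
  unfolding \<tau>_def using act_index_mult[OF m0 reflection_in_dihedral[OF i] reflection_in_dihedral[OF i], of j]
  by (simp add: reflection_involution act_index_one)

lemma \<tau>_i: "\<tau> i = i" using i by (simp add: \<tau>_eq)

lemma \<tau>_eq_iff: "j < m \<Longrightarrow> l < m \<Longrightarrow> \<tau> j = l \<longleftrightarrow> j = \<tau> l"
  using \<tau>_\<tau> by metis

lemma \<tau>_I: "j \<in> I \<Longrightarrow> \<tau> j \<in> I"
  using \<tau>_lt \<tau>_\<tau> \<tau>_i by (metis I_def DiffD1 DiffD2 DiffI lessThan_iff singletonD singletonI)

lemma reflection_\<tau>: "reflection m i ** reflection m j ** reflection m i = reflection m (\<tau> j)"
proof -
  have eq: "of_int (2 * int i - int j) * pi / real m = mirror_angle m i - mirror_angle m j + mirror_angle m i"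
    by (simp add: mirror_angle_def add_divide_distrib diff_divide_distrib algebra_simps)
  have "reflection m i ** reflection m j ** reflection m i
      = refl_matrix (mirror_angle m i - mirror_angle m j + mirror_angle m i)"
    by (simp only: reflection_eq refl_refl rot_refl)
  also have "\<dots> = reflection m (\<tau> j)"
    unfolding \<tau>_eq eq[symmetric] by (rule refl_matrix_eq_reflection[OF m0])
  finally show ?thesis .
qed

lemma \<psi>_\<tau>: "\<exists>n. \<psi> (\<tau> j) = - \<psi> j + of_int n * pi"
proof -
  obtain n where "of_int (2 * int i - int j) * pi / real m = mirror_angle m (nat ((2 * int i - int j) mod int m)) + of_int n * pi"
    by (rule mirror_angle_mod[OF m0])
  hence "\<psi> (\<tau> j) = - \<psi> j + of_int n * pi"
    by (simp add: \<psi>_def \<tau>_eq mirror_angle_def add_divide_distrib diff_divide_distrib algebra_simps)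
  thus ?thesis ..
qed

text \<open>The reflection \<open>s\<^sub>i\<close> maps the line of the path to itself by \<open>x \<mapsto> -x\<close>.\<close>
lemma y_\<tau>: "y (\<tau> j) = - y j"
proof -
  obtain n where n: "\<psi> (\<tau> j) = - \<psi> j + of_int n * pi" using \<psi>_\<tau> by blast
  have s: "sin (of_int n * pi) = 0" by (simp add: sin_zero_iff_int2)
  hence "cos (of_int n * pi) \<noteq> 0" by (metis one_neq_zero sin_cos_squared_add power_zero_numeral add_0)
  thus ?thesis
    unfolding y_def n by (simp add: sin_add cos_add s sin_diff cos_diff divide_simps)
qed

lemma pi_m: "pi / real m \<le> pi / 3" "pi / real m > 0"
proof -
  show "pi / real m \<le> pi / 3" by (rule divide_left_mono) (use m in auto)
qed (use m in auto)

lemma abs_\<phi>: "0 < \<bar>\<phi>\<bar>" "\<bar>\<phi>\<bar> < pi / real m" "\<bar>\<phi>\<bar> < pi / 2"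
proof -
  show "0 < \<bar>\<phi>\<bar>" "\<bar>\<phi>\<bar> < pi / real m" using sector by (simp_all add: \<phi>_def)
  with pi_m(1) pi_gt_zero show "\<bar>\<phi>\<bar> < pi / 2" by linarith
qed

lemma cos_\<phi>: "cos \<phi> > 0"
  using abs_\<phi>(3) by (intro cos_gt_zero_pi) auto

lemma sin_\<phi>: "sin \<phi> \<noteq> 0"
proof -
  have "\<bar>\<phi>\<bar> < pi" using abs_\<phi>(3) pi_gt_zero by linarith
  from sin_gt_zero[OF abs_\<phi>(1) this] show ?thesis by (auto simp: abs_if split: if_splits)
qed

lemma abs_cos_sin_less:
  assumes "j \<in> I"
  shows "\<bar>cos (\<psi> j) * sin \<phi>\<bar> < \<bar>sin (\<psi> j) * cos \<phi>\<bar>"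
  using mirror_angle_diff_bounds[OF i, of j] abs_\<phi>(2) pi_m(1) assms
  by (intro abs_tan_cot_less_one[where d="pi / m"]) (simp_all add: \<psi>_def I_def)

lemma sin_\<psi>: "j \<in> I \<Longrightarrow> sin (\<psi> j) \<noteq> 0"
  using abs_cos_sin_less[of j] by auto

lemma abs_y_lt_2: "j \<in> I \<Longrightarrow> \<bar>y j\<bar> < 2"
proof -
  assume j: "j \<in> I"
  have "\<bar>y j\<bar> = 2 * \<bar>cos (\<psi> j) * sin \<phi>\<bar> / \<bar>sin (\<psi> j) * cos \<phi>\<bar>"
    by (simp add: y_def abs_mult)
  also have "\<dots> < 2" using abs_cos_sin_less[OF j] by (subst pos_divide_less_eq) linarith+
  finally show ?thesis .
qed

lemma finite_I [simp]: "finite I" by (simp add: I_def)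

text \<open>
  The strict bound \<open>Y < 2\<close> places the whole path, which stays in the disc of radius \<open>1/2\<close>,
  inside the disc of convergence.
\<close>
lemma Y: "0 < Y" "Y < 2" "j \<in> I \<Longrightarrow> \<bar>y j\<bar> \<le> Y"
proof -
  have "1 \<le> Y" by (auto simp: Y_def)
  thus "0 < Y" by simp
  show "Y < 2" unfolding Y_def by (subst Max_less_iff) (auto simp: abs_y_lt_2)
  show "j \<in> I \<Longrightarrow> \<bar>y j\<bar> \<le> Y" unfolding Y_def by (intro Max_ge) auto
qed

definition "K = (\<Sum>j\<in>I. real CARD('n) * (real CARD('n) * (norm \<kappa> * \<bar>y j\<bar> * norm (B j))))"

lemma R_bound: "norm (R n) \<le> K * Y ^ n"
proof -
  have "norm (smat (- \<kappa> * of_real (y j) ^ Suc n) (B j)) \<le> real CARD('n) * (real CARD('n) * (norm \<kappa> * \<bar>y j\<bar> * norm (B j))) * Y ^ n"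
    if j: "j \<in> I" for j
  proof -
    have "norm (smat (- \<kappa> * of_real (y j) ^ Suc n) (B j)) \<le> real CARD('n) * (real CARD('n) * (norm \<kappa> * \<bar>y j\<bar> * norm (B j) * Y ^ n))"
    proof (rule matrix_norm_le)
      fix a b
      have "norm (smat (- \<kappa> * of_real (y j) ^ Suc n) (B j) $ a $ b) = norm \<kappa> * \<bar>y j\<bar> * (\<bar>y j\<bar> ^ n * norm (B j $ a $ b))"
        by (simp add: norm_mult norm_power)
      also have "\<dots> \<le> norm \<kappa> * \<bar>y j\<bar> * (Y ^ n * norm (B j))"
        using Y j by (intro mult_left_mono mult_mono power_mono matrix_entry_norm_le) auto
      finally show "norm (smat (- \<kappa> * of_real (y j) ^ Suc n) (B j) $ a $ b) \<le> norm \<kappa> * \<bar>y j\<bar> * norm (B j) * Y ^ n"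
        by (simp add: mult_ac)
    qed
    thus ?thesis by (simp add: mult_ac)
  qed
  from sum_norm_le[OF this] show ?thesis
    by (simp add: R_def K_def sum_distrib_right)
qed

lemma S_mult_S: "S ** S = mat 1"
  unfolding S_def using iota_mult[OF lab m0 reflection_in_dihedral[OF i] reflection_in_dihedral[OF i]]
  by (simp add: reflection_involution iota_one[OF lab])

lemma conj_iota:
  assumes "j < m"
  shows "S ** iota m lab (reflection m j) ** S = iota m lab (reflection m (\<tau> j))"
  using iota_mult[OF lab m0 dihedral_mult_reflection[OF m0 reflection_in_dihedral[OF i]] reflection_in_dihedral[OF i], of j]
    iota_mult[OF lab m0 reflection_in_dihedral[OF i] reflection_in_dihedral[OF assms]]
  by (simp add: S_def reflection_\<tau>)

lemma S_entry_permutation: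
  obtains \<sigma> :: "'n \<Rightarrow> 'n" where "\<And>a. lab (\<sigma> a) = \<tau> (lab a)" "\<And>(X::complex^'n^'n) a b. (S ** X) $ a $ b = X $ \<sigma> a $ b"
     "\<And>(X::complex^'n^'n) a b. (X ** S) $ a $ b = X $ a $ \<sigma> b"
proof -
  have "\<forall>a. \<exists>b. lab b = \<tau> (lab a)" using lab_surj \<tau>_lt by blast
  then obtain \<sigma> where \<sigma>: "\<And>a. lab (\<sigma> a) = \<tau> (lab a)" by metis
  have S1: "S $ a $ b = (if b = \<sigma> a then 1 else 0)" for a b
    using \<sigma>[of a] \<tau>_\<tau> lab_lt lab_eq_iff by (auto simp: S_def iota_def simp flip: \<tau>_def)
  have S2: "S $ a $ b = (if a = \<sigma> b then 1 else 0)" for a b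
    using \<sigma>[of b] lab_eq_iff by (auto simp: S_def iota_def simp flip: \<tau>_def) metis
  show ?thesis
  proof (rule that[OF \<sigma>])
    show "(S ** X) $ a $ b = X $ \<sigma> a $ b" for X :: "complex^'n^'n" and a b
      by (simp add: matrix_matrix_mult_def S1 if_distrib[of "\<lambda>x. x * _"] cong: if_cong)
    show "(X ** S) $ a $ b = X $ a $ \<sigma> b" for X :: "complex^'n^'n" and a b
      by (simp add: matrix_matrix_mult_def S2 if_distrib[of "\<lambda>x. _ * x"] cong: if_cong)
  qed
qed

lemma S_proj: "S ** proj_mat lab k \<alpha> i = proj_mat lab k \<alpha> i" "proj_mat lab k \<alpha> i ** S = proj_mat lab k \<alpha> i"
proof -
  obtain \<sigma> where \<sigma>: "\<And>a. lab (\<sigma> a) = \<tau> (lab a)" "\<And>(X::complex^'n^'n) a b. (S ** X) $ a $ b = X $ \<sigma> a $ b"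
     "\<And>(X::complex^'n^'n) a b. (X ** S) $ a $ b = X $ a $ \<sigma> b" by (rule S_entry_permutation) blast
  have "\<tau> (lab a) = i \<longleftrightarrow> lab a = i" for a using \<tau>_eq_iff[OF lab_lt i] \<tau>_i by simp
  thus "S ** proj_mat lab k \<alpha> i = proj_mat lab k \<alpha> i" "proj_mat lab k \<alpha> i ** S = proj_mat lab k \<alpha> i"
    unfolding vec_eq_iff \<sigma>(2,3) by (simp_all add: proj_mat_def \<sigma>(1))
qed

lemma conj_proj:
  assumes "j < m"
  shows "S ** proj_mat lab k \<alpha> j ** S = proj_mat lab k \<alpha> (\<tau> j)"
proof -
  obtain \<sigma> where \<sigma>: "\<And>a. lab (\<sigma> a) = \<tau> (lab a)" "\<And>(X::complex^'n^'n) a b. (S ** X) $ a $ b = X $ \<sigma> a $ b"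
     "\<And>(X::complex^'n^'n) a b. (X ** S) $ a $ b = X $ a $ \<sigma> b" by (rule S_entry_permutation) blast
  show ?thesis
    unfolding vec_eq_iff \<sigma>(2,3) by (simp add: proj_mat_def \<sigma>(1) \<tau>_eq_iff[OF lab_lt assms])
qed

lemma proj_square: "proj_mat lab k \<alpha> i ** proj_mat lab k \<alpha> i = smat \<alpha> (proj_mat lab k \<alpha> i)"
proof -
  obtain c0 where c0: "lab c0 = i" using lab_surj[OF i] by blast
  have lab_i: "lab a = i \<longleftrightarrow> a = c0" for a using c0 lab_eq_iff by metis
  show ?thesis
    by (auto simp: vec_eq_iff matrix_matrix_mult_def proj_mat_def lab_i if_distrib[of "\<lambda>x. _ * x"] cong: if_cong)
qed

lemma conj_B: "j < m \<Longrightarrow> S ** B j ** S = B (\<tau> j)"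
  by (simp add: B_def matrix_algebra conj_iota conj_proj)

text \<open>
  Conjugation by \<open>S\<close> permutes the residues by \<open>\<tau>\<close>, and \<open>y\<^sub>\<tau>\<^sub>j = - y\<^sub>j\<close> turns the reindexed sum
  into a sign.
\<close>
lemma conj_R: "S ** R n ** S = smat ((-1) ^ Suc n) (R n)"
proof -
  have "S ** R n ** S = (\<Sum>j\<in>I. smat (- \<kappa> * of_real (y j) ^ Suc n) (B (\<tau> j)))"
    by (simp add: R_def sum_matrix_mult_left sum_matrix_mult_right smat_mult_left smat_mult_right conj_B I_def)
  also have "\<dots> = (\<Sum>j\<in>I. smat (- \<kappa> * of_real (y (\<tau> j)) ^ Suc n) (B j))"
    using \<tau>_I \<tau>_\<tau> by (intro sum.reindex_bij_witness[of _ \<tau> \<tau>]) (simp_all add: I_def)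
  also have "\<dots> = smat ((-1) ^ Suc n) (R n)"
    by (simp add: R_def y_\<tau> smat_sum smat_smat power_minus[of "of_real _"] mult_ac)
  finally show ?thesis .
qed

end

lemma cvec_linear: "cvec (x + y) = cvec x + cvec y" "cvec (x - y) = cvec x - cvec y" "cvec (t *\<^sub>R x) = of_real t *s cvec x"
  by (simp_all add: vec_eq_iff)

text \<open>
  A linear form is determined up to a nonzero scalar by its kernel, and the logarithmic
  derivative does not see the scalar.
\<close>
lemma omega_eq_line_form:
  assumes lin: "Vector_Spaces.linear (*s) (*) g" and ker: "{x. g x = 0} = mirror m j"
  shows "omega g x u = line_form (mirror_angle m j) u / line_form (mirror_angle m j) x"
proof -
  interpret g: Vector_Spaces.linear "(*s)" "(*)" g by (rule lin)
  define \<theta> where "\<theta> = mirror_angle m j"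
  define g1 g2 where "g1 = g (axis 1 1)" and "g2 = g (axis 2 1)"
  have g: "g x = x $ 1 * g1 + x $ 2 * g2" for x
  proof -
    have "x = x $ 1 *s axis 1 1 + x $ 2 *s axis 2 1" by (simp add: vec_eq_iff forall_2 axis_def)
    hence "g x = g (x $ 1 *s axis 1 1 + x $ 2 *s axis 2 1)" by simp
    thus ?thesis by (simp only: g.add g.scale g1_def g2_def)
  qed
  have ker': "g x = 0 \<longleftrightarrow> line_form \<theta> x = 0" for x
    using ker by (auto simp: mirror_eq_line line_at_def \<theta>_def)
  \<comment> \<open>the scalar is the value of \<open>g\<close> at the unit normal of the mirror\<close>
  define lam where "lam = of_real (cos \<theta>) * g2 - of_real (sin \<theta>) * g1"
  have "g (cvec (direction \<theta>)) = 0" unfolding ker' by (simp add: line_form_def)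
  hence eq: "of_real (cos \<theta>) * g1 = - of_real (sin \<theta>) * g2" by (simp add: g eq_neg_iff_add_eq_0)
  have one: "of_real (cos \<theta>) * of_real (cos \<theta>) + of_real (sin \<theta>) * of_real (sin \<theta>) = (1 :: complex)"
    by (metis of_real_1 of_real_add of_real_mult power2_eq_square sin_cos_squared_add2)
  have g_eq: "g x = lam * line_form \<theta> x" for x
  proof -
    have "lam * line_form \<theta> x = x $ 1 * g1 * (of_real (sin \<theta>) * of_real (sin \<theta>)) + x $ 2 * g2 * (of_real (cos \<theta>) * of_real (cos \<theta>))
      + x $ 1 * of_real (cos \<theta>) * (- of_real (sin \<theta>) * g2) - x $ 2 * of_real (sin \<theta>) * (of_real (cos \<theta>) * g1)"
      by (simp add: lam_def line_form_def algebra_simps)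
    also have "\<dots> = x $ 1 * g1 * (of_real (cos \<theta>) * of_real (cos \<theta>) + of_real (sin \<theta>) * of_real (sin \<theta>))
      + x $ 2 * g2 * (of_real (cos \<theta>) * of_real (cos \<theta>) + of_real (sin \<theta>) * of_real (sin \<theta>))"
      unfolding eq[symmetric] by (subst (2) eq) (simp add: algebra_simps)
    finally show ?thesis unfolding one by (simp add: g)
  qed
  have "lam \<noteq> 0"
  proof
    assume "lam = 0"
    hence "line_form \<theta> x = 0" for x using g_eq[of x] ker'[of x] by simp
    from this[of "axis 1 1"] this[of "axis 2 1"] have "sin \<theta> = 0" "cos \<theta> = 0" by (simp_all add: line_form_def axis_def)
    thus False using sin_cos_squared_add[of \<theta>] by simp
  qed
  have "(line_form \<theta> has_derivative line_form \<theta>) (at x)"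
    unfolding line_form_def[abs_def]
    by (auto intro!: derivative_eq_intros bounded_linear.has_derivative[OF bounded_linear_vec_nth])
  hence "(g has_derivative g) (at x)"
    unfolding g_eq[abs_def] by (auto intro!: derivative_eq_intros)
  hence "frechet_derivative g (at x) = g" by (rule frechet_derivative_at[symmetric])
  thus ?thesis using \<open>lam \<noteq> 0\<close> by (simp add: omega_def g_eq \<theta>_def)
qed

context braid_generator
begin

sublocale fp: frobenius_problem S "proj_mat lab k \<alpha> i" \<alpha> k \<kappa> R K Y
proof
  show "S ** S = mat 1" by (rule S_mult_S)
  show "S ** proj_mat lab k \<alpha> i = proj_mat lab k \<alpha> i" "proj_mat lab k \<alpha> i ** S = proj_mat lab k \<alpha> i"
    by (rule S_proj)+
  show "proj_mat lab k \<alpha> i ** proj_mat lab k \<alpha> i = smat \<alpha> (proj_mat lab k \<alpha> i)" by (rule proj_square)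
  show "2 * \<kappa> * k \<noteq> of_int n \<and> \<kappa> * \<alpha> \<noteq> of_int n \<and> \<kappa> * (2 * k - \<alpha>) \<noteq> of_int n" if "n \<noteq> 0" for n
    using that by (rule nonresonant_params)
  show "norm (R n) \<le> K * Y ^ n" for n by (rule R_bound)
  show "Y > 0" by (rule Y)
  show "S ** R n ** S = smat ((-1) ^ Suc n) (R n)" for n by (rule conj_R)
qed

text \<open>
  \<open>a\<close> spans the line of the path, \<open>mid\<close> is its intersection with the mirror, and \<open>pt\<close> is the
  parametrisation by \<open>x\<close>.
\<close>
definition "p = c *\<^sub>R direction \<beta>"
definition "a = reflection m i *v p - p"
definition "mid = p + (1/2) *\<^sub>R a"
definition "pt x = cvec mid + x *s cvec a"

lemma reflection_p: "reflection m i *v p = c *\<^sub>R direction (2 * mirror_angle m i - \<beta>)"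
  by (simp add: p_def reflection_eq matrix_vector_mult_scaleR refl_direction)

lemma line_form_a: "line_form (mirror_angle m j) (cvec a) = of_real (- 2 * c * cos (\<psi> j) * sin \<phi>)"
  and line_form_mid: "line_form (mirror_angle m j) (cvec mid) = of_real (c * sin (\<psi> j) * cos \<phi>)"
proof -
  define \<theta> where "\<theta> = mirror_angle m j"
  have 1: "line_form \<theta> (cvec p) = of_real (c * sin (\<psi> j + \<phi>))"
    unfolding p_def line_form_direction by (simp add: \<psi>_def \<phi>_def \<theta>_def)
  have 2: "line_form \<theta> (cvec (reflection m i *v p)) = of_real (c * sin (\<psi> j - \<phi>))"
    unfolding reflection_p line_form_direction by (simp add: \<psi>_def \<phi>_def \<theta>_def algebra_simps)
  have "a + p = reflection m i *v p" by (simp add: a_def)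
  hence "line_form \<theta> (cvec a) = of_real (c * sin (\<psi> j - \<phi>)) - of_real (c * sin (\<psi> j + \<phi>))"
    using 1 2 by (metis cvec_linear(1) line_form_linear(1) add_diff_cancel_right')
  also have "\<dots> = of_real (- 2 * c * cos (\<psi> j) * sin \<phi>)"
    unfolding of_real_diff[symmetric] by (simp only: of_real_eq_iff) (simp add: sin_add sin_diff algebra_simps)
  finally show a: "line_form \<theta> (cvec a) = of_real (- 2 * c * cos (\<psi> j) * sin \<phi>)" .
  have "line_form \<theta> (cvec mid) = of_real (c * sin (\<psi> j + \<phi>)) + of_real (1/2) * of_real (- 2 * c * cos (\<psi> j) * sin \<phi>)"
    unfolding mid_def cvec_linear line_form_linear 1 a ..
  also have "\<dots> = of_real (c * sin (\<psi> j) * cos \<phi>)"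
    unfolding of_real_add[symmetric] of_real_mult[symmetric] by (simp only: of_real_eq_iff) (simp add: sin_add sin_diff algebra_simps)
  finally show "line_form \<theta> (cvec mid) = of_real (c * sin (\<psi> j) * cos \<phi>)" .
qed

lemma line_form_a_y:
  assumes "j \<in> I"
  shows "line_form (mirror_angle m j) (cvec a) = - of_real (y j) * line_form (mirror_angle m j) (cvec mid)"
    "line_form (mirror_angle m j) (cvec mid) \<noteq> 0"
proof -
  have nz: "sin (\<psi> j) \<noteq> 0" "cos \<phi> \<noteq> 0" using sin_\<psi>[OF assms] cos_\<phi> by auto
  thus "line_form (mirror_angle m j) (cvec mid) \<noteq> 0" using c by (simp add: line_form_mid)
  have "- 2 * c * cos (\<psi> j) * sin \<phi> = - y j * (c * sin (\<psi> j) * cos \<phi>)" using nz by (simp add: y_def)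
  thus "line_form (mirror_angle m j) (cvec a) = - of_real (y j) * line_form (mirror_angle m j) (cvec mid)"
    unfolding line_form_a line_form_mid by (simp only: of_real_mult of_real_minus)
qed

lemma line_form_i: "line_form (mirror_angle m i) (cvec a) \<noteq> 0" "line_form (mirror_angle m i) (cvec mid) = 0"
  using c sin_\<phi> by (simp_all add: line_form_a line_form_mid \<psi>_def)

lemma line_form_pt:
  "j \<in> I \<Longrightarrow> line_form (mirror_angle m j) (pt x) = line_form (mirror_angle m j) (cvec mid) * (1 - of_real (y j) * x)"
  "line_form (mirror_angle m i) (pt x) = x * line_form (mirror_angle m i) (cvec a)"
  by (simp_all add: pt_def line_form_linear line_form_a_y line_form_i algebra_simps)

lemma norm_y_mult_lt_1:
  fixes x :: complex
  assumes "norm x * Y < 1" "j \<in> I"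
  shows "norm (of_real (y j) * x) < 1" "of_real (y j) * x \<noteq> 1"
proof -
  have "norm (of_real (y j) * x) = \<bar>y j\<bar> * norm x" by (simp add: norm_mult)
  also have "\<dots> \<le> Y * norm x" using Y(3)[OF assms(2)] by (intro mult_right_mono) auto
  finally show "norm (of_real (y j) * x) < 1" using assms by (simp add: mult.commute)
  thus "of_real (y j) * x \<noteq> 1" by (metis norm_one less_irrefl)
qed

lemma pt_in_complement:
  assumes "x \<noteq> 0" "norm x * Y < 1"
  shows "pt x \<in> arr_complement m"
proof -
  have "line_form (mirror_angle m j) (pt x) \<noteq> 0" if "j < m" for j
    using that assms norm_y_mult_lt_1[OF assms(2), of j] by (cases "j = i") (auto simp: line_form_pt line_form_i line_form_a_y I_def)
  thus ?thesis by (auto simp: arr_complement_def mirror_eq_line line_at_def)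
qed

lemma R_series:
  assumes "norm x * Y < 1"
  shows "matrix_series R x = (\<Sum>j\<in>I. smat (- \<kappa> * of_real (y j) / (1 - of_real (y j) * x)) (B j))"
proof -
  have "(\<lambda>n. R n $ b $ d * x ^ n) sums (\<Sum>j\<in>I. smat (- \<kappa> * of_real (y j) / (1 - of_real (y j) * x)) (B j)) $ b $ d" for b d
  proof -
    have "(\<lambda>n. \<Sum>j\<in>I. (- \<kappa> * of_real (y j) * B j $ b $ d) * (of_real (y j) * x) ^ n) sums
       (\<Sum>j\<in>I. (- \<kappa> * of_real (y j) * B j $ b $ d) * (1 / (1 - of_real (y j) * x)))"
      by (intro sums_sum sums_mult geometric_sums norm_y_mult_lt_1 assms)
    thus ?thesis by (simp add: R_def sum_distrib_left power_mult_distrib mult_ac)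
  qed
  thus ?thesis by (simp add: vec_eq_iff matrix_series_def sums_iff)
qed

text \<open>
  On \<open>pt x\<close> the form of the mirror \<open>i\<close> is a multiple of \<open>x\<close> and that of \<open>j \<in> I\<close> is a multiple of
  \<open>1 - y\<^sub>j x\<close>. Their logarithmic derivatives are the pole \<open>A / x\<close> and the summands of \<open>R(x)\<close>.
\<close>
lemma connection_pt:
  assumes x: "x \<noteq> 0" "norm x * Y < 1"
  shows "connection m lab f k \<alpha> \<kappa> (pt x) (x' *s cvec a) = smat x' (fp.coeff x)"
proof -
  have om: "omega (f j) (pt x) (x' *s cvec a) = line_form (mirror_angle m j) (x' *s cvec a) / line_form (mirror_angle m j) (pt x)"
    if "j < m" for j by (rule omega_eq_line_form[OF f_linear[OF that] f_kernel[OF that]])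
  have om_i: "omega (f i) (pt x) (x' *s cvec a) = x' * (1 / x)"
    using om[OF i] line_form_i by (simp add: line_form_pt line_form_linear)
  have om_j: "omega (f j) (pt x) (x' *s cvec a) = x' * (- of_real (y j) / (1 - of_real (y j) * x))" if "j \<in> I" for j
  proof -
    have "omega (f j) (pt x) (x' *s cvec a) = (line_form (mirror_angle m j) (cvec mid) * (x' * - of_real (y j))) /
      (line_form (mirror_angle m j) (cvec mid) * (1 - of_real (y j) * x))"
      using om[of j] that line_form_a_y(1)[OF that] by (simp add: line_form_pt line_form_linear I_def)
    thus ?thesis using line_form_a_y(2)[OF that] by simp
  qed
  have "connection m lab f k \<alpha> \<kappa> (pt x) (x' *s cvec a) = smat \<kappa> (\<Sum>j<m. smat (omega (f j) (pt x) (x' *s cvec a)) (B j))"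
    by (simp add: connection_def B_def)
  also have "(\<Sum>j<m. smat (omega (f j) (pt x) (x' *s cvec a)) (B j)) =
      smat (x' * (1 / x)) (B i) + (\<Sum>j\<in>I. smat (x' * (- of_real (y j) / (1 - of_real (y j) * x))) (B j))"
    using i by (subst sum.remove[of _ i]) (auto simp: om_i om_j I_def)
  also have "smat \<kappa> (smat (x' * (1 / x)) (B i) + (\<Sum>j\<in>I. smat (x' * (- of_real (y j) / (1 - of_real (y j) * x))) (B j))) =
     smat \<kappa> (smat (x' * (1 / x)) (smat k S - proj_mat lab k \<alpha> i) +
      (\<Sum>j\<in>I. smat (x' * (- of_real (y j) / (1 - of_real (y j) * x))) (B j)))"
    by (simp add: B_def S_def)
  also have "smat \<kappa> (smat (x' * (1 / x)) (smat k S - proj_mat lab k \<alpha> i) +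
      (\<Sum>j\<in>I. smat (x' * (- of_real (y j) / (1 - of_real (y j) * x))) (B j))) = smat x' (fp.coeff x)"
    unfolding fp.coeff_def fp.A_def R_series[OF x(2)] smat_add smat_sum smat_smat
    by (intro arg_cong2[where f="(+)"] sum.cong arg_cong2[where f=smat]) (simp_all add: mult_ac)
  finally show ?thesis .
qed

lemma a_mid_orthogonal: "mid \<bullet> a = 0"
proof -
  have n: "direction \<theta> \<bullet> direction \<theta> = 1" for \<theta>
    by (simp add: inner_vec_def sum_2 flip: power2_eq_square)
  have "mid = (1/2) *\<^sub>R (p + reflection m i *v p)"
    by (simp add: mid_def a_def vec_eq_iff field_simps)
  moreover have "((1/2) *\<^sub>R (u + v)) \<bullet> (v - u) = (1/2) * (v \<bullet> v - u \<bullet> u)" for u v :: "real^2"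
    by (simp add: inner_add_left inner_diff_right inner_commute[of u v] field_simps)
  ultimately have "mid \<bullet> a = (1/2) * ((reflection m i *v p) \<bullet> (reflection m i *v p) - p \<bullet> p)"
    unfolding a_def by metis
  also have "\<dots> = 0" unfolding reflection_p by (simp add: p_def n)
  finally show ?thesis .
qed

lemma a_nonzero: "a \<noteq> 0"
  using line_form_i(1) by (auto simp: line_form_def)

text \<open>
  The centre of the half circle is \<open>mid\<close>: \<open>a\<close> is orthogonal to \<open>mid\<close>, so the quotient of inner
  products in its definition is the coordinate \<open>r - 1/2\<close> of its starting point.
\<close>
lemma sigma_path_eq: "sigma_path m p r i = (\<lambda>t. pt (detour r t))"
proof -
  define p' where "p' = p + r *\<^sub>R a"
  have p: "p = mid - (1/2) *\<^sub>R a" by (simp add: mid_def)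
  have p': "p' = mid + (r - 1/2) *\<^sub>R a" by (simp add: p'_def p algebra_simps)
  have sp: "reflection m i *v p = mid + (1/2) *\<^sub>R a" by (simp add: mid_def a_def algebra_simps flip: scaleR_2)
  have sa: "reflection m i *v a = - a"
    unfolding a_def matrix_vector_mult_diff_distrib matrix_vector_mul_assoc by (simp add: reflection_involution)
  have sp': "reflection m i *v p' = mid + (1/2 - r) *\<^sub>R a"
    unfolding p'_def matrix_vector_right_distrib matrix_vector_mult_scaleR sa sp by (simp add: algebra_simps)
  have line: "linepath (cvec (mid + s *\<^sub>R a)) (cvec (mid + t *\<^sub>R a)) v = pt (linepath (of_real s) (of_real t) v)" for s t v
    by (simp add: linepath_def pt_def vec_eq_iff scaleR_conv_of_real[where 'a=complex] algebra_simps)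
  have inner: "(p' \<bullet> a) / (a \<bullet> a) = r - 1/2"
    using a_nonzero by (simp add: p' inner_add_left a_mid_orthogonal)
  have circle: "half_circle p' a v = pt ((of_real r - 1/2) * exp (of_real (pi * v) * \<i>))" for v
    unfolding half_circle_def inner unfolding pt_def p' by (simp add: vec_eq_iff algebra_simps)
  have first: "linepath (cvec p) (cvec p') v = pt (linepath (-1/2) (of_real r - 1/2) v)" for v
    using line[of "-1/2" "r - 1/2" v] p p' by simp
  have last: "linepath (cvec (reflection m i *v p')) (cvec (reflection m i *v p)) v = pt (linepath (1/2 - of_real r) (1/2) v)" for v
    using line[of "1/2 - r" "1/2" v] unfolding sp sp' by simp
  show ?thesis
    unfolding sigma_path_def Let_def a_def[symmetric] p'_def[symmetric] detour_def joinpaths_def first last circle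
    by (auto simp: fun_eq_iff)
qed

lemma detour_cut_disc:
  assumes "t \<in> {0..1}"
  shows "detour r t \<in> fp.cut_disc" "detour r t \<noteq> 0" "norm (detour r t) * Y < 1"
proof -
  note d = detour_range[OF r assms]
  have "norm (detour r t) * Y \<le> (1/2) * Y" using d(3) Y(1) by (intro mult_right_mono) auto
  also have "\<dots> < 1" using Y(2) by simp
  finally show "norm (detour r t) * Y < 1" .
  with d show "detour r t \<in> fp.cut_disc" "detour r t \<noteq> 0" by (auto intro: fp.cut_disc_lower)
qed

lemma continuous_detour: "continuous_on {0..1} (detour r)"
  using valid_path_imp_path[OF valid_path_detour] by (simp add: path_def)

lemma detour_differentiable:
  obtains N where "finite N" "\<And>t. t \<in> {0..1} - N \<Longrightarrow> \<exists>x'. (detour r has_vector_derivative x') (at t within {0..1})"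
  using valid_path_detour[of r] unfolding valid_path_def piecewise_C1_differentiable_on_def C1_differentiable_on_def
  by (metis has_vector_derivative_at_within)

text \<open>
  The tangent vector of the path is unique wherever it exists, so it is \<open>x' \<cdot> a\<close>. The
  exceptional parameters are those of the flat section together with the corners of the path.
\<close>
lemma flat_along_iff:
  "flat_along m (connection m lab f k \<alpha> \<kappa>) (sigma_path m p r i) F \<longleftrightarrow> fp.line_solution (detour r) F"
proof
  obtain N0 where N0: "finite N0" "\<And>t. t \<in> {0..1} - N0 \<Longrightarrow> \<exists>x'. (detour r has_vector_derivative x') (at t within {0..1})"
    by (rule detour_differentiable) blast
  have rhs: "connection m lab f k \<alpha> \<kappa> (pt (detour r t)) (x' *s cvec a) *v F t = x' *s (fp.coeff (detour r t) *v F t)"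
    if "t \<in> {0..1}" for x' t
    using connection_pt[OF detour_cut_disc(2,3)[OF that]] by (simp add: smat_matrix_vector)
  have deriv: "((\<lambda>t. pt (detour r t)) has_vector_derivative x' *s cvec a) (at t within {0..1})"
    if "(detour r has_vector_derivative x') (at t within {0..1})" for x' t
    unfolding pt_def by (rule has_vector_derivative_vector_scale[OF that])
  {
    assume "flat_along m (connection m lab f k \<alpha> \<kappa>) (sigma_path m p r i) F"
    then obtain N where "continuous_on {0..1} F" and N: "finite N" "\<And>t. t \<in> {0..1} - N \<Longrightarrow> \<exists>u.
        ((\<lambda>t. pt (detour r t)) has_vector_derivative u) (at t within {0..1}) \<and>
        (F has_vector_derivative connection m lab f k \<alpha> \<kappa> (pt (detour r t)) u *v F t) (at t within {0..1})"
      unfolding flat_along_def sigma_path_eq by blast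
    moreover have "\<exists>x'. (detour r has_vector_derivative x') (at t within {0..1}) \<and>
        (F has_vector_derivative x' *s (fp.coeff (detour r t) *v F t)) (at t within {0..1})"
      if t: "t \<in> {0..1} - (N \<union> N0)" for t
    proof -
      obtain x' where x': "(detour r has_vector_derivative x') (at t within {0..1})" using N0 t by blast
      obtain u where u: "((\<lambda>t. pt (detour r t)) has_vector_derivative u) (at t within {0..1})"
        "(F has_vector_derivative connection m lab f k \<alpha> \<kappa> (pt (detour r t)) u *v F t) (at t within {0..1})"
        using N t by blast
      have "u = x' *s cvec a"
        by (rule vector_derivative_unique_within[OF _ u(1) deriv[OF x']]) (use t in \<open>simp add: trivial_limit_within islimpt_Icc\<close>)
      thus ?thesis using x' u(2) rhs t by auto
    qed
    ultimately show "fp.line_solution (detour r) F"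
      unfolding fp.line_solution_def using N(1) N0(1) by (metis finite_UnI)
  }
  {
    assume "fp.line_solution (detour r) F"
    then obtain N where "continuous_on {0..1} F" and N: "finite N" "\<And>t. t \<in> {0..1} - N \<Longrightarrow>
        \<exists>x'. (detour r has_vector_derivative x') (at t within {0..1}) \<and>
        (F has_vector_derivative x' *s (fp.coeff (detour r t) *v F t)) (at t within {0..1})"
      unfolding fp.line_solution_def by blast
    moreover have "path_image (\<lambda>t. pt (detour r t)) \<subseteq> arr_complement m"
      using detour_cut_disc by (auto simp: path_image_def intro!: pt_in_complement)
    moreover have "\<exists>u. ((\<lambda>t. pt (detour r t)) has_vector_derivative u) (at t within {0..1}) \<and>
        (F has_vector_derivative connection m lab f k \<alpha> \<kappa> (pt (detour r t)) u *v F t) (at t within {0..1})"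
      if t: "t \<in> {0..1} - N" for t
      using N(2)[OF t] t deriv rhs by (metis DiffD1)
    ultimately show "flat_along m (connection m lab f k \<alpha> \<kappa>) (sigma_path m p r i) F"
      unfolding flat_along_def sigma_path_eq by blast
  }
qed

lemma sin_\<beta>_nz:
  assumes "j < m"
  shows "sin (\<beta> - mirror_angle m j) \<noteq> 0"
proof -
  have eq: "\<beta> - mirror_angle m j = \<psi> j + \<phi>" by (simp add: \<psi>_def \<phi>_def)
  show ?thesis
  proof (cases "j = i")
    case True
    thus ?thesis using sin_\<phi> by (simp add: \<phi>_def)
  next
    case False
    hence "\<bar>cos (\<psi> j) * sin \<phi>\<bar> < \<bar>sin (\<psi> j) * cos \<phi>\<bar>" using assms by (intro abs_cos_sin_less) (simp add: I_def)
    moreover have "sin (\<psi> j + \<phi>) = sin (\<psi> j) * cos \<phi> + cos (\<psi> j) * sin \<phi>" by (rule sin_add)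
    ultimately show ?thesis unfolding eq by linarith
  qed
qed

text \<open>
  The base point lies on no mirror, so no reflection fixes it, and a rotation that fixes a
  nonzero vector is trivial.
\<close>
lemma dihedral_free_at_p:
  assumes "w \<in> dihedral m" "cact w (cvec p) = cvec p"
  shows "w = mat 1"
proof -
  have "w *v p = p" using assms(2) by (simp add: cact_cvec vec_eq_iff)
  hence w: "w *v direction \<beta> = direction \<beta>" using c by (simp add: p_def matrix_vector_mult_scaleR)
  have dirD: "sin (\<gamma> - \<beta>) = 0" "cos (\<gamma> - \<beta>) = 1" if "direction \<gamma> = direction \<beta>" for \<gamma>
  proof -
    have "sin \<gamma> = sin \<beta>" "cos \<gamma> = cos \<beta>" using that by (metis direction_nth)+
    thus "sin (\<gamma> - \<beta>) = 0" "cos (\<gamma> - \<beta>) = 1" by (simp_all add: sin_diff cos_diff flip: power2_eq_square)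
  qed
  from assms(1) consider j where "w = rotation m j" | j where "j < m" "w = reflection m j"
    by (auto simp: dihedral_def)
  thus ?thesis
  proof cases
    case 1
    have "direction (\<beta> + 2 * mirror_angle m j) = direction \<beta>"
      using w by (simp add: 1 rotation_eq rot_direction)
    from dirD[OF this] show ?thesis
      by (simp add: 1 rotation_eq rot_matrix_def vec_eq_iff forall_2 mat_def)
  next
    case 2
    have "direction (2 * mirror_angle m j - \<beta>) = direction \<beta>"
      using w by (simp add: 2 reflection_eq refl_direction)
    from dirD(2)[OF this] have "cos (2 * (\<beta> - mirror_angle m j)) = 1"
      using cos_minus[of "2 * (\<beta> - mirror_angle m j)"] by (simp add: algebra_simps)
    hence "sin (\<beta> - mirror_angle m j) = 0" using cos_double_sin[of "\<beta> - mirror_angle m j"] by simp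
    thus ?thesis using sin_\<beta>_nz[OF 2(1)] by contradiction
  qed
qed

text \<open>
  In the quotient bundle the fibre over the end point is identified with the fibre over \<open>p\<close> by
  \<open>\<iota>(s\<^sub>i)\<close>; freeness of the action at \<open>p\<close> excludes any further identification.
\<close>
lemma quotient_pt_eq_iff:
  "quotient_pt m lab (cvec p) v = quotient_pt m lab (cact (reflection m i) (cvec p)) v' \<longleftrightarrow> v = S *v v'"
proof
  have inD: "w ** reflection m i \<in> dihedral m" if "w \<in> dihedral m" for w
    by (rule dihedral_mult_reflection[OF m0 that])
  have ws: "(w ** reflection m i) ** reflection m i = w" for w
    by (simp add: reflection_involution flip: matrix_mul_assoc)
  have iota_ws: "iota m lab (w ** reflection m i) = iota m lab w ** S" if "w \<in> dihedral m" for w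
    unfolding S_def by (rule iota_mult[OF lab m0 that reflection_in_dihedral[OF i]])
  {
    assume "quotient_pt m lab (cvec p) v = quotient_pt m lab (cact (reflection m i) (cvec p)) v'"
    moreover have "(cvec p, v) \<in> quotient_pt m lab (cvec p) v"
      unfolding quotient_pt_def by (rule image_eqI[OF _ one_in_dihedral[OF m0]]) (simp add: iota_one[OF lab])
    ultimately obtain w where w: "w \<in> dihedral m" "cvec p = cact w (cact (reflection m i) (cvec p))" "v = iota m lab w *v v'"
      by (auto simp: quotient_pt_def)
    have "w ** reflection m i = mat 1"
      using w inD by (intro dihedral_free_at_p) (simp_all add: cact_mult)
    hence "w = reflection m i" using ws[of w] by simp
    thus "v = S *v v'" using w(3) by (simp add: S_def)
  next
    assume v: "v = S *v v'"
    show "quotient_pt m lab (cvec p) v = quotient_pt m lab (cact (reflection m i) (cvec p)) v'"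
    proof
      show "quotient_pt m lab (cvec p) v \<subseteq> quotient_pt m lab (cact (reflection m i) (cvec p)) v'"
        unfolding quotient_pt_def
      proof (rule image_subsetI)
        fix w assume w: "w \<in> dihedral m"
        show "(cact w (cvec p), iota m lab w *v v) \<in> (\<lambda>w. (cact w (cact (reflection m i) (cvec p)), iota m lab w *v v')) ` dihedral m"
          by (rule image_eqI[OF _ inD[OF w]])
             (simp add: v iota_ws[OF w] matrix_vector_mul_assoc ws flip: cact_mult)
      qed
      show "quotient_pt m lab (cact (reflection m i) (cvec p)) v' \<subseteq> quotient_pt m lab (cvec p) v"
        unfolding quotient_pt_def
      proof (rule image_subsetI)
        fix w assume w: "w \<in> dihedral m"
        show "(cact w (cact (reflection m i) (cvec p)), iota m lab w *v v') \<in> (\<lambda>w. (cact w (cvec p), iota m lab w *v v)) ` dihedral m"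
          by (rule image_eqI[OF _ inD[OF w]])
             (simp add: v iota_ws[OF w] matrix_vector_mul_assoc cact_mult, simp add: S_mult_S flip: matrix_mul_assoc)
      qed
    qed
  }
qed

text \<open>
  The operator \<open>T\<close> in the definition of the monodromy exists and is unique: every vector is the
  initial value of a flat section, and the section's end value is determined by it.
\<close>
lemma T_LK_conjugate:
  obtains G G' where "G ** G' = mat 1" "G' ** G = mat 1"
    "T_LK m lab f k \<alpha> \<kappa> (sigma_path m p r i) = G ** (S ** fp.residue_exp k (\<kappa> * \<i> * pi)) ** G'"
proof -
  obtain N where N: "finite N" "\<And>t. t \<in> {0..1} - N \<Longrightarrow> \<exists>x'. (detour r has_vector_derivative x') (at t within {0..1})"
    by (rule detour_differentiable) blast
  have sub: "detour r ` {0..1} \<subseteq> fp.cut_disc" using detour_cut_disc by auto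
  have ends: "(1/2 :: real) > 0" "detour r 0 = - of_real (1/2)" "detour r 1 = of_real (1/2)"
    by (simp_all add: detour_ends)
  obtain G G' where G: "G ** G' = mat 1" "G' ** G = mat 1"
    "\<And>v. \<exists>F. fp.line_solution (detour r) F \<and> F 0 = v"
    "\<And>F. fp.line_solution (detour r) F \<Longrightarrow> S *v F 1 = (G ** (S ** fp.residue_exp k (\<kappa> * \<i> * pi)) ** G') *v F 0"
    using fp.half_turn_monodromy[OF continuous_detour sub N ends] by blast
  have start: "pathstart (sigma_path m p r i) = cvec p"
    unfolding pathstart_def sigma_path_eq detour_ends by (simp add: pt_def mid_def vec_eq_iff)
  have finish: "pathfinish (sigma_path m p r i) = cact (reflection m i) (cvec p)"
    unfolding pathfinish_def sigma_path_eq detour_ends cact_cvec by (simp add: pt_def mid_def a_def vec_eq_iff field_simps)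
  have "T_LK m lab f k \<alpha> \<kappa> (sigma_path m p r i) = G ** (S ** fp.residue_exp k (\<kappa> * \<i> * pi)) ** G'"
    unfolding T_LK_def flat_along_iff start finish quotient_pt_eq_iff
  proof (rule the_equality)
    show "\<forall>F. fp.line_solution (detour r) F \<longrightarrow> (G ** (S ** fp.residue_exp k (\<kappa> * \<i> * pi)) ** G') *v F 0 = S *v F 1"
      using G(4) by simp
    fix T assume T: "\<forall>F. fp.line_solution (detour r) F \<longrightarrow> T *v F 0 = S *v F 1"
    show "T = G ** (S ** fp.residue_exp k (\<kappa> * \<i> * pi)) ** G'"
      unfolding matrix_eq using T G(3,4) by metis
  qed
  with G show ?thesis using that by blast
qed

text \<open>
  The matrix of \<open>p\<^sub>i\<close> has a single nonzero row; it is nonzero because \<open>k \<noteq> 0\<close> and there is an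
  index other than \<open>i\<close>. So \<open>p\<^sub>i\<close> is an outer product of nonzero vectors, a property that
  conjugation preserves.
\<close>
lemma rank_conj_proj:
  assumes G: "G ** G' = mat 1" "G' ** G = mat 1" and z: "z \<noteq> 0"
  shows "rank (smat z (G ** proj_mat lab k \<alpha> i ** G')) = 1"
proof -
  obtain c0 where c0: "lab c0 = i" using lab_surj[OF i] by blast
  have lab_i: "lab d = i \<longleftrightarrow> d = c0" for d using c0 lab_eq_iff by metis
  define u where "u = z *s (G *v axis c0 1)"
  define row where "row = (\<chi> d. if d = c0 then \<alpha> else k)"
  define v where "v = row v* G'"
  show ?thesis
  proof (rule rank_outer_product)
    fix d e
    have P: "proj_mat lab k \<alpha> i $ d $ e = (if d = c0 then row $ e else 0)" for d e
      by (simp add: proj_mat_def lab_i row_def)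
    have "(G ** proj_mat lab k \<alpha> i) $ d $ e = G $ d $ c0 * row $ e" for d e
      by (simp add: matrix_matrix_mult_def P if_distrib[of "\<lambda>x. _ * x"] cong: if_cong)
    hence "(G ** proj_mat lab k \<alpha> i ** G') $ d $ e = G $ d $ c0 * v $ e"
      by (simp add: matrix_matrix_mult_def[of _ G'] v_def vector_matrix_mult_def sum_distrib_left mult_ac)
    moreover have "G $ d $ c0 = (G *v axis c0 1) $ d"
      by (simp add: matrix_vector_mult_def axis_def if_distrib[of "\<lambda>x. _ * x"] cong: if_cong)
    ultimately show "smat z (G ** proj_mat lab k \<alpha> i ** G') $ d $ e = u $ d * v $ e"
      by (simp add: u_def)
  next
    have "G' *v (G *v axis c0 1) = axis c0 1" by (simp add: matrix_vector_mul_assoc G)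
    hence "G *v axis c0 1 \<noteq> 0" by auto
    thus "u \<noteq> 0" using z by (simp add: u_def)
  next
    obtain j where j: "j < m" "j \<noteq> i" using m by (metis One_nat_def Suc_lessD Suc_1 less_le_trans n_not_Suc_n numeral_3_eq_3 lessI zero_less_Suc)
    then obtain d where "lab d = j" using lab_surj by blast
    hence "row $ d = k" using j by (auto simp: row_def simp flip: lab_i)
    hence "row \<noteq> 0" using k by auto
    moreover have "v v* G = row" by (simp add: v_def vector_matrix_mul_assoc G)
    ultimately show "v \<noteq> 0" by auto
  qed
qed

text \<open>
  In coordinates \<open>S exp(\<pi> \<i> A)\<close> is \<open>(q, - 1/q, q x)\<close> with \<open>1 + \<alpha> x = exp(- \<pi> \<i> \<kappa> \<alpha>)\<close>. The
  product of its differences to \<open>q\<close> and \<open>- 1/q\<close> is \<open>w p\<close> with \<open>w = q x (1/q + 1/l)\<close>. The scalars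
  \<open>x\<close>, \<open>1/q - q\<close> and \<open>1/q + 1/l\<close> vanish, for \<open>\<kappa> \<noteq> 0\<close>, only if one of \<open>\<kappa> \<alpha>\<close>, \<open>2 \<kappa> k\<close>, \<open>\<kappa> (2 k -
  \<alpha>)\<close> is a nonzero integer.
\<close>
theorem generator_relations:
  assumes \<kappa>: "\<kappa> \<noteq> 0"
  defines "q \<equiv> exp (\<kappa> * k * of_real pi * \<i>)"
  defines "l \<equiv> exp (\<kappa> * \<alpha> * of_real pi * \<i>) / q"
  defines "T \<equiv> T_LK m lab f k \<alpha> \<kappa> (sigma_path m p r i)"
  shows "(T - mat (inverse l)) ** (T - mat q) ** (T + mat (inverse q)) = 0"
    "rank (smat (l / (inverse q - q)) ((T - mat q) ** (T + mat (inverse q)))) = 1"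
proof -
  define P where "P = proj_mat lab k \<alpha> i"
  define u where "u = \<kappa> * \<i> * complex_of_real pi"
  define x where "x = fp.p_exponent u"
  obtain G G' where G: "G ** G' = mat 1" "G' ** G = mat 1" and T: "T = G ** (S ** fp.residue_exp k u) ** G'"
    unfolding T_def u_def by (rule T_LK_conjugate)
  have q: "q = exp (k * u)" "inverse q = exp (- k * u)" "q \<noteq> 0"
    by (simp_all add: q_def u_def mult_ac exp_minus)
  have l: "inverse l = q * exp (- \<alpha> * u)" "l \<noteq> 0"
    by (simp_all add: l_def q_def u_def mult_ac exp_minus divide_simps)
  have ax: "\<alpha> * (q * x) = inverse l - q"
  proof -
    have "inverse l = q * (1 + \<alpha> * x)" unfolding l x_def fp.p_exponent_eq ..
    thus ?thesis by (simp add: algebra_simps)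
  qed
  have M: "S ** fp.residue_exp k u = fp.elt q (- inverse q) (q * x)"
    unfolding fp.residue_exp_def q x_def by (subst fp.S_eq_elt) (simp add: fp.elt_mult exp_minus)
  have conj: "G ** C ** G' ** (G ** D ** G') = G ** (C ** D) ** G'" for C D
  proof -
    have "G ** C ** G' ** (G ** D ** G') = G ** C ** (G' ** G) ** D ** G'" by (simp only: matrix_mul_assoc)
    thus ?thesis by (simp add: G matrix_mul_assoc)
  qed
  have mat_conj: "mat z = G ** fp.elt z z 0 ** G'" for z
  proof -
    have "mat z = smat z (mat 1 :: complex^'n^'n)" by (simp add: vec_eq_iff mat_def)
    thus ?thesis unfolding fp.mat_eq_elt[symmetric] by (simp add: matrix_algebra G)
  qed
  have T_minus: "T - mat z = G ** fp.elt (q - z) (- inverse q - z) (q * x) ** G'"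
    and T_plus: "T + mat z = G ** fp.elt (q + z) (- inverse q + z) (q * x) ** G'" for z
    unfolding T M mat_conj by (simp_all add: fp.elt_diff fp.elt_add flip: matrix_algebra(1-4))
  define w where "w = q * x * (inverse q + inverse l)"
  have w_eq: "(q - q) * (q * x) + q * x * (q + inverse q) + \<alpha> * (q * x) * (q * x) = w"
    unfolding ax w_def by (simp add: algebra_simps)
  have w: "(T - mat q) ** (T + mat (inverse q)) = G ** fp.elt 0 0 w ** G'"
    unfolding T_minus T_plus conj fp.elt_mult w_eq by simp
  have third: "(q - inverse l) * w + q * x * 0 + \<alpha> * (q * x) * w = 0"
    unfolding ax by (simp add: algebra_simps)
  have "fp.elt 0 0 0 = 0" by (simp add: fp.elt_def)
  thus "(T - mat (inverse l)) ** (T - mat q) ** (T + mat (inverse q)) = 0"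
    unfolding matrix_mul_assoc[of "T - mat (inverse l)", symmetric] w
    unfolding T_minus conj fp.elt_mult third
    by (simp add: matrix_mul_zero_left matrix_mul_zero_right)
  have scalar: "z = of_int n" if "z * (\<i> * complex_of_real pi) = of_int n * (\<i> * complex_of_real pi)" for z n
    using that by simp
  have "x \<noteq> 0"
  proof
    assume x0: "x = 0"
    hence "\<alpha> \<noteq> 0" using \<kappa> by (auto simp: x_def fp.p_exponent_def u_def)
    have "exp 0 = exp (- \<alpha> * u)" using fp.p_exponent_eq[of u] x0 by (simp flip: x_def)
    then obtain n where "0 = - \<alpha> * u + (of_int (2 * n) * pi) * \<i>" unfolding exp_eq by blast
    hence "\<kappa> * \<alpha> = of_int (2 * n)"
      by (intro scalar) (simp add: u_def algebra_simps)
    thus False using nonresonant_params[of "2 * n"] \<kappa> \<open>\<alpha> \<noteq> 0\<close> by (cases "n = 0") auto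
  qed
  moreover have "inverse q - q \<noteq> 0"
  proof
    assume "inverse q - q = 0"
    hence "exp (k * u) = exp (- k * u)" using q by simp
    then obtain n where "k * u = - k * u + (of_int (2 * n) * pi) * \<i>" unfolding exp_eq by blast
    hence "2 * \<kappa> * k = of_int (2 * n)"
      by (intro scalar) (simp add: u_def algebra_simps)
    thus False using nonresonant_params[of "2 * n"] \<kappa> k by (cases "n = 0") auto
  qed
  moreover have "inverse q + inverse l \<noteq> 0"
  proof
    assume "inverse q + inverse l = 0"
    hence "inverse l = - inverse q" by (simp add: eq_neg_iff_add_eq_0 add.commute)
    hence "exp (k * u - \<alpha> * u) = exp (- k * u + \<i> * pi)"
      unfolding l q by (simp add: exp_add exp_diff exp_minus field_simps)
    then obtain n where "k * u - \<alpha> * u = - k * u + \<i> * pi + (of_int (2 * n) * pi) * \<i>" unfolding exp_eq by blast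
    hence "\<kappa> * (2 * k - \<alpha>) = of_int (2 * n + 1)"
      by (intro scalar) (simp add: u_def algebra_simps)
    moreover have "2 * n + 1 \<noteq> 0" by presburger
    ultimately show False using nonresonant_params[of "2 * n + 1"] by blast
  qed
  ultimately have nz: "x \<noteq> 0" "inverse q - q \<noteq> 0" "inverse q + inverse l \<noteq> 0" by blast+
  have "smat (l / (inverse q - q)) (G ** fp.elt 0 0 w ** G') = smat (l / (inverse q - q) * w) (G ** P ** G')"
    by (simp add: fp.elt_def P_def matrix_algebra)
  thus "rank (smat (l / (inverse q - q)) ((T - mat q) ** (T + mat (inverse q)))) = 1"
    unfolding w P_def by (simp only: , intro rank_conj_proj G) (use nz q l in \<open>auto simp: w_def\<close>)
qed

end

section \<open>Generic parameters\<close>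

lemma sin_pi_times_nonzero:
  fixes z :: complex
  assumes "z \<noteq> 0" "norm z < 1"
  shows "sin (of_real pi * z) \<noteq> 0"
proof
  assume "sin (of_real pi * z) = 0"
  then obtain n :: int where "of_real pi * z = of_real (n * pi)" by (auto simp: sin_eq_0)
  hence z: "z = of_int n" by simp
  hence "\<bar>of_int n :: real\<bar> < 1" using assms(2) by (simp add: norm_of_int)
  hence "n = 0" by linarith
  thus False using assms(1) z by simp
qed

lemma sin_pi_times_int: "sin (complex_of_real pi * of_int n) = 0"
  by (auto simp: sin_eq_0 intro!: exI[of _ n])

text \<open>
  The set of zeros of a product of functions \<open>sin (\<pi> b \<kappa>)\<close> contains the resonant parameters. For
  \<open>b = 0\<close> the number \<open>\<kappa> b\<close> is never a nonzero integer while the sine vanishes identically, so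
  there the factor is \<open>1\<close>. The product is an entire function that is not identically zero: \<open>sin
  (\<pi> b \<kappa>)\<close> with \<open>b \<noteq> 0\<close> has no zeros near \<open>\<kappa> = 0\<close> except \<open>\<kappa> = 0\<close> itself. The factor with \<open>b = 2
  k \<noteq> 0\<close> also excludes \<open>\<kappa> = 0\<close>.
\<close>
lemma generically_nonresonant:
  fixes k \<alpha> :: complex
  assumes k: "k \<noteq> 0"
    and P: "\<And>\<kappa>. \<kappa> \<noteq> 0 \<Longrightarrow> (\<And>n::int. n \<noteq> 0 \<Longrightarrow>
       2 * \<kappa> * k \<noteq> of_int n \<and> \<kappa> * \<alpha> \<noteq> of_int n \<and> \<kappa> * (2 * k - \<alpha>) \<noteq> of_int n) \<Longrightarrow> P \<kappa>"
  shows "generically P"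
proof -
  define factor where "factor = (\<lambda>b \<kappa>. if b = 0 then 1 else sin (of_real pi * (\<kappa> * b)) :: complex)"
  define g where "g = (\<lambda>\<kappa>. factor (2 * k) \<kappa> * factor \<alpha> \<kappa> * factor (2 * k - \<alpha>) \<kappa>)"
  have hol: "factor b holomorphic_on UNIV" for b
    unfolding factor_def by (cases "b = 0") (auto intro!: holomorphic_intros)
  have ghol: "g holomorphic_on UNIV" unfolding g_def by (intro holomorphic_intros hol)
  show ?thesis
    unfolding generically_def
  proof (intro exI conjI allI impI)
    show "analytic_subset {\<kappa>. g \<kappa> = 0}"
      unfolding analytic_subset_def using ghol by (intro allI exI[of _ UNIV] exI[of _ "{g}"]) auto
    \<comment> \<open>small enough that \<open>norm (e b) < 1\<close> for the three relevant \<open>b\<close>\<close>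
    define e where "e = 1 / (1 + norm (2 * k) + norm \<alpha> + norm (2 * k - \<alpha>))"
    have pos: "0 < 1 + norm (2 * k) + norm \<alpha> + norm (2 * k - \<alpha>)"
      using norm_ge_zero[of "2 * k"] norm_ge_zero[of \<alpha>] norm_ge_zero[of "2 * k - \<alpha>"] by linarith
    hence e: "e > 0" by (simp add: e_def)
    have "factor b (of_real e) \<noteq> 0" if "norm b < 1 + norm (2 * k) + norm \<alpha> + norm (2 * k - \<alpha>)" for b
    proof (cases "b = 0")
      case False
      have "norm (of_real e * b) = e * norm b" using e by (simp add: norm_mult)
      also have "\<dots> = norm b / (1 + norm (2 * k) + norm \<alpha> + norm (2 * k - \<alpha>))"
        by (simp add: e_def)
      also have "\<dots> < 1" using that pos by (simp add: divide_less_eq)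
      finally show ?thesis using False e sin_pi_times_nonzero[of "of_real e * b"] by (simp add: factor_def)
    qed (simp add: factor_def)
    moreover have "norm (2 * k) < 1 + norm (2 * k) + norm \<alpha> + norm (2 * k - \<alpha>)"
      "norm \<alpha> < 1 + norm (2 * k) + norm \<alpha> + norm (2 * k - \<alpha>)"
      "norm (2 * k - \<alpha>) < 1 + norm (2 * k) + norm \<alpha> + norm (2 * k - \<alpha>)"
      using norm_ge_zero[of "2 * k"] norm_ge_zero[of \<alpha>] norm_ge_zero[of "2 * k - \<alpha>"] by linarith+
    ultimately have "g (of_real e) \<noteq> 0" by (simp add: g_def)
    thus "{\<kappa>. g \<kappa> = 0} \<noteq> UNIV" by blast
  next
    fix \<kappa> assume "\<kappa> \<notin> {\<kappa>. g \<kappa> = 0}"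
    hence nz: "factor (2 * k) \<kappa> \<noteq> 0" "factor \<alpha> \<kappa> \<noteq> 0" "factor (2 * k - \<alpha>) \<kappa> \<noteq> 0" by (auto simp: g_def)
    have nonint: "\<kappa> * b \<noteq> of_int n" if "factor b \<kappa> \<noteq> 0" "n \<noteq> 0" for b n
      using that sin_pi_times_int[of n] by (auto simp: factor_def split: if_splits)
    show "P \<kappa>"
    proof (rule P)
      show "\<kappa> \<noteq> 0" using nz(1) k by (auto simp: factor_def)
      fix n :: int assume "n \<noteq> 0"
      thus "2 * \<kappa> * k \<noteq> of_int n \<and> \<kappa> * \<alpha> \<noteq> of_int n \<and> \<kappa> * (2 * k - \<alpha>) \<noteq> of_int n"
        using nonint[OF nz(1)] nonint[OF nz(2)] nonint[OF nz(3)] by (simp add: mult_ac)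
    qed
  qed
qed

theorem lemma3p1:
  fixes m :: nat and k \<alpha> :: complex
    and lab :: "'n::finite \<Rightarrow> nat"
    and f :: "nat \<Rightarrow> complex^2 \<Rightarrow> complex"
    and p :: "real^2" and r :: "nat \<Rightarrow> real"
  assumes m: "m \<ge> 3" "odd m"
    and k: "k \<noteq> 0"
    and lab: "bij_betw lab UNIV {..<m}"
    and f_linear: "\<And>i. i < m \<Longrightarrow> Vector_Spaces.linear (*s) (*) (f i)"
    and f_kernel: "\<And>i. i < m \<Longrightarrow> {x. f i x = 0} = mirror m i"
    and p: "p \<in> base_sector m"
    and r: "\<And>i. i \<in> {0, 1} \<Longrightarrow> 0 < r i \<and> r i < 1 / 2"
  shows "generically (\<lambda>\<kappa>.
    let q = exp (\<kappa> * k * of_real pi * \<i>);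
        l = exp (\<kappa> * \<alpha> * of_real pi * \<i>) / q
    in \<forall>i \<in> {0, 1}.
      let T = T_LK m lab f k \<alpha> \<kappa> (sigma_path m p (r i) i);
          e = smat (l / (inverse q - q)) ((T - mat q) ** (T + mat (inverse q)))
      in (T - mat (inverse l)) ** (T - mat q) ** (T + mat (inverse q)) = 0 \<and>
         rank e = 1)"
proof (rule generically_nonresonant[OF k])
  fix \<kappa> :: complex
  assume \<kappa>: "\<kappa> \<noteq> 0" and nonres: "\<And>n::int. n \<noteq> 0 \<Longrightarrow>
       2 * \<kappa> * k \<noteq> of_int n \<and> \<kappa> * \<alpha> \<noteq> of_int n \<and> \<kappa> * (2 * k - \<alpha>) \<noteq> of_int n"
  obtain c \<beta> where p_eq: "p = c *\<^sub>R direction \<beta>" and c: "0 < c" and \<beta>: "0 < \<beta>" "\<beta> < pi / real m"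
    using p by (auto simp: base_sector_def)
  have gen: "braid_generator m lab f k \<alpha> \<kappa> i c \<beta> (r i)" if i: "i \<in> {0, 1}" for i
  proof (rule braid_generator.intro)
    show "3 \<le> m" "bij_betw lab UNIV {..<m}" "k \<noteq> 0" "0 < c" by fact+
    show "i < m" using m i by auto
    show "\<beta> \<noteq> mirror_angle m i" "\<bar>\<beta> - mirror_angle m i\<bar> < pi / real m"
      using i \<beta> by (auto simp: mirror_angle_def)
    show "0 < r i" "r i < 1 / 2" using r[OF i] by auto
  qed (fact f_linear f_kernel nonres)+
  note relations = braid_generator.generator_relations[OF gen \<kappa>]
  show "let q = exp (\<kappa> * k * of_real pi * \<i>);
        l = exp (\<kappa> * \<alpha> * of_real pi * \<i>) / q
    in \<forall>i \<in> {0, 1}.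
      let T = T_LK m lab f k \<alpha> \<kappa> (sigma_path m p (r i) i);
          e = smat (l / (inverse q - q)) ((T - mat q) ** (T + mat (inverse q)))
      in (T - mat (inverse l)) ** (T - mat q) ** (T + mat (inverse q)) = 0 \<and>
         rank e = 1"
    unfolding Let_def p_eq using relations braid_generator.p_def[OF gen] by auto
qed

end
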